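(* Let $m\ge 1$ be the number of identical machines, let $J$ be a finite nonempty set of jobs with positive rational processing times $p_j$ ($j\in J$), and let $\alpha<0$ and $\beta>0$ be rational cooling and heating rates. Consider the objective of minimizing the sum of completion times on $m$ machines. Then there is an optimal normal schedule in which the jobs are completed in order from smallest to largest processing time. That is, there is a feasible normal schedule $S$ (for $m$ machines) with $$\sum_{j\in J}C_j(S)=\inf\Big\{\sum_{j\in J}C_j(S') : S' \text{ a feasible normal schedule for } m \text{ machines}\Big\}$$ such that for all $i,j\in J$ with $p_i<p_j$ we have $C_i(S)\le C_j(S)$.
   Context: A schedule $S=(S_j:j\in J)$ for a finite set of jobs $J$ consists of a load function $S_j:\mathbb{R}_+\to\mathbb{R}_+$ for each job $j$ (where $\mathbb{R}_+=[0,\infty)$), assumed (locally) integrable; $S_j(t)$ is the fractional load of job $j$ at time $t$. The schedule is manageable on $m$ machines if for all $t\ge 0$ we have $\sum_{j\in J}S_j(t)\le m$ and $S_j(t)\le 1$ for every $j\in J$ (a job is never processed by more than one machine at a time). A schedule determines for each job $j$ a temperature $T_j:\mathbb{R}_+\to\mathbb{R}_+$, the (absolutely continuous) function with $T_j(0)=0$ and, for (almost every) $t$, $$\frac{\partial}{\partial t}T_j(t)=\begin{cases}\alpha(1-S_j(t))+\beta S_j(t) & \text{if } T_j(t)>0,\\ \max\{0,\alpha(1-S_j(t))+\beta S_j(t)\} & \text{if } T_j(t)=0.\end{cases}$$ The schedule is feasible for $m$ machines if it is manageable on $m$ machines and $T_j(t)\le 1$ for all $j\in J$, $t\ge 0$.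 The work on job $j$ up to time $t$ is $W_j(t)=\int_0^t S_j(s)\,ds$. The completion time of job $j$ is $C_j(S)=\min\{t\in\mathbb{R}_+: p_j\le W_j(t)\}$. Only schedules in which every job is completed (all $C_j(S)$ finite) are considered. A schedule is simple if there are $0=t_0<t_1<\dots<t_k$ such that $S_j(t)=S_j(t')$ for all $t,t'\in[t_{i-1},t_i)$, all $j\in J$ and all $i=1,\dots,k$; then its simplicity is said to be witnessed by $\{t_1,\dots,t_k\}$. A schedule is normal if it is simple with simplicity witnessed by $\{C_j(S):j\in J\}$, i.e. all loads are constant between successive completion times (starting from time $0$). *)

theory Defs
  imports "HOL-Analysis.Analysis"
begin

text \<open>
  Functions on the half line \<open>[0,\<infinity>)\<close> are represented by total functions on \<^typ>\<open>real\<close>,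
  and all conditions only concern arguments \<open>t \<ge> 0\<close>. A schedule is a function \<open>S\<close> where
  \<open>S j t\<close> is the load of job \<open>j\<close> at time \<open>t\<close>; only jobs \<open>j \<in> J\<close> matter.
\<close>

definition is_schedule :: "'j set \<Rightarrow> ('j \<Rightarrow> real \<Rightarrow> real) \<Rightarrow> bool" where
  "is_schedule J S \<longleftrightarrow>
     (\<forall>j\<in>J. (\<forall>t\<ge>0. 0 \<le> S j t) \<and> (\<forall>t\<ge>0. S j absolutely_integrable_on {0..t}))"

definition manageable :: "nat \<Rightarrow> 'j set \<Rightarrow> ('j \<Rightarrow> real \<Rightarrow> real) \<Rightarrow> bool" where
  "manageable m J S \<longleftrightarrow>
     (\<forall>t\<ge>0. (\<Sum>j\<in>J. S j t) \<le> real m \<and> (\<forall>j\<in>J. S j t \<le> 1))"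

text \<open>
  The usual epsilon-delta notion of absolute continuity. A division consists of finitely many
  non-overlapping compact intervals \<open>k = {Inf k..Sup k}\<close>.
\<close>

definition absolutely_continuous_fun_on :: "real set \<Rightarrow> (real \<Rightarrow> real) \<Rightarrow> bool" where
  "absolutely_continuous_fun_on A f \<longleftrightarrow>
     (\<forall>\<epsilon>>0. \<exists>\<delta>>0. \<forall>D U. D division_of U \<and> U \<subseteq> A \<and> (\<Sum>k\<in>D. Sup k - Inf k) < \<delta>
        \<longrightarrow> (\<Sum>k\<in>D. \<bar>f (Sup k) - f (Inf k)\<bar>) < \<epsilon>)"

definition heat_rate :: "real \<Rightarrow> real \<Rightarrow> real \<Rightarrow> real \<Rightarrow> real" where
  "heat_rate \<alpha> \<beta> s \<theta> =
     (if \<theta> > 0 then \<alpha> * (1 - s) + \<beta> * s else max 0 (\<alpha> * (1 - s) + \<beta> * s))"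

text \<open>\<open>is_temperature \<alpha> \<beta> s T\<close>: \<open>T\<close> is the temperature of a job with load function \<open>s\<close>.\<close>

definition is_temperature ::
    "real \<Rightarrow> real \<Rightarrow> (real \<Rightarrow> real) \<Rightarrow> (real \<Rightarrow> real) \<Rightarrow> bool" where
  "is_temperature \<alpha> \<beta> s T \<longleftrightarrow>
     (\<forall>t\<ge>0. 0 \<le> T t) \<and> T 0 = 0 \<and>
     (\<forall>b\<ge>0. absolutely_continuous_fun_on {0..b} T) \<and>
     (AE t in lebesgue. 0 < t \<longrightarrow> (T has_real_derivative heat_rate \<alpha> \<beta> (s t) (T t)) (at t))"

text \<open>
  The load function determines the temperature uniquely on \<open>[0,\<infinity>)\<close>, so the existential
  quantifier below does not leave a choice.
\<close>

definition feasible ::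
    "real \<Rightarrow> real \<Rightarrow> nat \<Rightarrow> 'j set \<Rightarrow> ('j \<Rightarrow> real \<Rightarrow> real) \<Rightarrow> bool" where
  "feasible \<alpha> \<beta> m J S \<longleftrightarrow> is_schedule J S \<and> manageable m J S \<and>
     (\<forall>j\<in>J. \<exists>T. is_temperature \<alpha> \<beta> (S j) T \<and> (\<forall>t\<ge>0. T t \<le> 1))"

definition work :: "('j \<Rightarrow> real \<Rightarrow> real) \<Rightarrow> 'j \<Rightarrow> real \<Rightarrow> real" where
  "work S j t = integral {0..t} (S j)"

definition all_completed :: "('j \<Rightarrow> real) \<Rightarrow> 'j set \<Rightarrow> ('j \<Rightarrow> real \<Rightarrow> real) \<Rightarrow> bool" where
  "all_completed p J S \<longleftrightarrow> (\<forall>j\<in>J. \<exists>t\<ge>0. p j \<le> work S j t)"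

text \<open>The least such time exists for completed jobs, since work is continuous in time.\<close>

definition completion_time :: "('j \<Rightarrow> real) \<Rightarrow> ('j \<Rightarrow> real \<Rightarrow> real) \<Rightarrow> 'j \<Rightarrow> real" where
  "completion_time p S j = (LEAST t. 0 \<le> t \<and> p j \<le> work S j t)"

definition simple_witnessed_by :: "'j set \<Rightarrow> ('j \<Rightarrow> real \<Rightarrow> real) \<Rightarrow> real set \<Rightarrow> bool" where
  "simple_witnessed_by J S A \<longleftrightarrow>
     (\<exists>(k::nat) (\<tau>::nat \<Rightarrow> real). \<tau> 0 = 0 \<and> strict_mono_on {0..k} \<tau> \<and> A = \<tau> ` {1..k} \<and>
        (\<forall>i\<in>{1..k}. \<forall>j\<in>J. \<forall>t\<in>{\<tau> (i - 1)..<\<tau> i}. \<forall>t'\<in>{\<tau> (i - 1)..<\<tau> i}. S j t = S j t'))"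

definition normal_schedule :: "('j \<Rightarrow> real) \<Rightarrow> 'j set \<Rightarrow> ('j \<Rightarrow> real \<Rightarrow> real) \<Rightarrow> bool" where
  "normal_schedule p J S \<longleftrightarrow> simple_witnessed_by J S (completion_time p S ` J)"

definition feasible_normal_schedules ::
    "real \<Rightarrow> real \<Rightarrow> nat \<Rightarrow> ('j \<Rightarrow> real) \<Rightarrow> 'j set \<Rightarrow> ('j \<Rightarrow> real \<Rightarrow> real) set" where
  "feasible_normal_schedules \<alpha> \<beta> m p J =
     {S. feasible \<alpha> \<beta> m J S \<and> all_completed p J S \<and> normal_schedule p J S}"

end

theory Submission
  imports Defs
begin

text \<open>
  Write \<open>\<sigma> = - \<alpha> / (\<beta> - \<alpha>)\<close> for the load at which the temperature is stationary and
  \<open>H = 1 / (\<beta> - \<alpha>)\<close>. A temperature is the reflection at \<open>0\<close> of the drift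
  \<open>(\<beta> - \<alpha>) (W t - \<sigma> t)\<close>, where \<open>W\<close> is the work done so far, so the bound \<open>T \<le> 1\<close> says exactly
  that \<open>W v - W u \<le> H + \<sigma> (v - u)\<close> for all \<open>u \<le> v\<close>. Feasibility thereby becomes a family of
  closed conditions on increments of the work functions alone (\<open>profile\<close>), and a schedule
  becomes a \<open>plan\<close>: work functions together with a deadline for each job, by which the job is
  done. The passage from schedules to plans (\<open>plan_of_schedule\<close>) needs that an absolutely
  continuous function with nonnegative derivative almost everywhere is nondecreasing. For the
  way back, a plan may be interpolated between its deadlines (\<open>profile_interp\<close>) without
  violating any condition, which makes the loads constant between deadlines.

  By Tychonoff's theorem the plans with bounded deadlines form a compact set. Hence there are
  deadlines \<open>d\<close> with least sum and, among those, with greatest \<open>\<Sum>j. p j * d j\<close>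
  (\<open>optimal_exists\<close>). No job of such a plan is done before its deadline, so the deadlines are the
  completion times.

  Suppose that \<open>p b < p a\<close> and nevertheless \<open>d a < d b\<close>. If the two deadlines could be exchanged,
  the sum would stay the same and \<open>\<Sum>j. p j * d j\<close> would grow, a contradiction. To exchange
  them (\<open>swap_deadlines\<close>), let \<open>s\<close> be the first time at which \<open>a\<close> is ahead of \<open>b\<close> by
  \<open>p a - p b\<close> and interchange the loads of \<open>a\<close> and \<open>b\<close> after \<open>s\<close>. Job \<open>b\<close> does not become
  too hot, because \<open>s\<close> is the first such time: in every interval that ends at \<open>s\<close> job \<open>a\<close> did at
  least as much work as \<open>b\<close>. Job \<open>a\<close> could become too hot on the way to its new deadline
  \<open>d b\<close>, but not at \<open>d b\<close> itself. So it suffices that \<open>W b t - \<sigma> t\<close> has no interior peak before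
  \<open>d b\<close>, and this holds if the load of \<open>b\<close> never decreases before \<open>d b\<close>.

  Such loads exist. Among all plans for \<open>d\<close> take one with least energy, the integral of the
  squares of the loads. If the load of \<open>b\<close> dropped at some time, a little of its work could be
  postponed past that time: either the machines have room there, or some other job has a load
  that rises at this time and does a little of its work earlier. The heat conditions leave room
  for both moves, and the energy would decrease (\<open>least_energy_slopes\<close>).
\<close>

section \<open>Piecewise affine functions on a grid of times\<close>

locale time_grid =
  fixes \<tau> :: "nat \<Rightarrow> real"
  assumes strict: "strict_mono \<tau>" and start: "\<tau> 0 = 0" and unbounded: "\<And>t. \<exists>i. t < \<tau> i"
begin

lemma tau_less: "\<tau> i < \<tau> j \<longleftrightarrow> i < j"
  by (rule strict_mono_less[OF strict])

lemma tau_le: "\<tau> i \<le> \<tau> j \<longleftrightarrow> i \<le> j"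
  by (rule strict_mono_less_eq[OF strict])

lemma tau_nonneg: "0 \<le> \<tau> i"
  using tau_le[of 0 i] start by simp

lemma step_pos: "0 < \<tau> (Suc i) - \<tau> i"
  using tau_less[of i "Suc i"] by simp

definition cell :: "real \<Rightarrow> nat" where
  "cell t = (LEAST i. t < \<tau> (Suc i))"

definition slope :: "(nat \<Rightarrow> real) \<Rightarrow> nat \<Rightarrow> real" where
  "slope V i = (V (Suc i) - V i) / (\<tau> (Suc i) - \<tau> i)"

definition interp :: "(nat \<Rightarrow> real) \<Rightarrow> real \<Rightarrow> real" where
  "interp V t = V (cell t) + slope V (cell t) * (t - \<tau> (cell t))"

lemma cell_upper: "t < \<tau> (Suc (cell t))"
proof -
  obtain i where "t < \<tau> i" using unbounded by blast
  then have "t < \<tau> (Suc i)" using tau_less[of i "Suc i"] by linarith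
  then show ?thesis unfolding cell_def by (rule LeastI)
qed

lemma cell_lower:
  assumes "0 \<le> t" shows "\<tau> (cell t) \<le> t"
proof (cases "cell t")
  case 0
  then show ?thesis using assms start by simp
next
  case (Suc n)
  then have "\<not> t < \<tau> (Suc n)" unfolding cell_def by (intro not_less_Least) simp
  then show ?thesis using Suc by simp
qed

lemma cell_eqI:
  assumes "\<tau> i \<le> t" "t < \<tau> (Suc i)" shows "cell t = i"
proof -
  have "0 \<le> t" using assms(1) tau_nonneg[of i] by linarith
  then have "\<tau> (cell t) < \<tau> (Suc i)" "\<tau> i < \<tau> (Suc (cell t))"
    using cell_lower[of t] cell_upper[of t] assms by linarith+
  then show ?thesis by (simp add: tau_less)
qed

lemma cell_tau: "cell (\<tau> i) = i"
  using step_pos[of i] by (intro cell_eqI) auto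

lemma cell_mono:
  assumes "0 \<le> u" "u \<le> v" shows "cell u \<le> cell v"
proof -
  have "\<tau> (cell u) < \<tau> (Suc (cell v))"
    using cell_lower[of u] cell_upper[of v] assms by linarith
  then show ?thesis by (simp add: tau_less)
qed

lemma interp_on_cell:
  assumes "\<tau> i \<le> t" "t \<le> \<tau> (Suc i)"
  shows "interp V t = V i + slope V i * (t - \<tau> i)"
proof (cases "t = \<tau> (Suc i)")
  case True
  then show ?thesis using step_pos[of i]
    by (simp add: interp_def cell_tau) (simp add: slope_def)
next
  case False
  then have "cell t = i" using assms by (intro cell_eqI) auto
  then show ?thesis by (simp add: interp_def)
qed

lemma interp_tau: "interp V (\<tau> i) = V i"
  by (simp add: interp_def cell_tau)

lemma slope_times_step: "slope V i * (\<tau> (Suc i) - \<tau> i) = V (Suc i) - V i"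
  using step_pos[of i] by (simp add: slope_def)

text \<open>
  On a cell both \<open>interp V\<close> and the line are affine, so it is enough to compare them at its
  two ends.
\<close>

lemma interp_below_line:
  assumes "0 \<le> t"
    and "V (cell t) \<le> A + B * \<tau> (cell t)" "V (Suc (cell t)) \<le> A + B * \<tau> (Suc (cell t))"
  shows "interp V t \<le> A + B * t"
proof -
  define i where "i = cell t"
  define l where "l = (t - \<tau> i) / (\<tau> (Suc i) - \<tau> i)"
  have l: "0 \<le> l" "l \<le> 1" "t - \<tau> i = l * (\<tau> (Suc i) - \<tau> i)"
    using cell_lower[OF assms(1)] cell_upper[of t] step_pos[of i] unfolding l_def i_def
    by (auto simp: field_simps)
  have "slope V i * (t - \<tau> i) = l * (V (Suc i) - V i)"
    unfolding l(3) slope_times_step[of V i, symmetric] by (simp add: mult_ac)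
  then have "interp V t = (1 - l) * V i + l * V (Suc i)"
    unfolding interp_def i_def[symmetric] by (simp add: algebra_simps)
  also have "\<dots> \<le> (1 - l) * (A + B * \<tau> i) + l * (A + B * \<tau> (Suc i))"
    using l assms(2,3) unfolding i_def by (intro add_mono mult_left_mono) auto
  also have "\<dots> = A + B * (\<tau> i + l * (\<tau> (Suc i) - \<tau> i))"
    by (simp add: algebra_simps)
  also have "\<dots> = A + B * t" using l(3) by (metis add.commute diff_add_cancel)
  finally show ?thesis .
qed

lemma interp_uminus: "interp (\<lambda>i. - V i) t = - interp V t"
proof -
  have "slope (\<lambda>i. - V i) i = - slope V i" for i
    using minus_divide_left[of "V (Suc i) - V i" "\<tau> (Suc i) - \<tau> i"] by (simp add: slope_def)
  then show ?thesis by (simp add: interp_def)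
qed

lemma interp_above_line:
  assumes "0 \<le> t"
    and "A + B * \<tau> (cell t) \<le> V (cell t)" "A + B * \<tau> (Suc (cell t)) \<le> V (Suc (cell t))"
  shows "A + B * t \<le> interp V t"
  using interp_below_line[of t "\<lambda>i. - V i" "- A" "- B"] assms by (simp add: interp_uminus)

lemma interp_sum: "interp (\<lambda>i. \<Sum>j\<in>J. V j i) t = (\<Sum>j\<in>J. interp (V j) t)"
proof -
  have "slope (\<lambda>i. \<Sum>j\<in>J. V j i) i = (\<Sum>j\<in>J. slope (V j) i)" for i
    by (simp add: slope_def flip: sum_divide_distrib sum_subtractf)
  then show ?thesis by (simp add: interp_def sum.distrib sum_distrib_right)
qed

text \<open>
  Every condition on work functions (monotonicity, the speed of one machine and of all machines,
  the heat bound) has the form of this two-point inequality, so this lemma lets interpolation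
  preserve all of them. For \<open>u\<close> and \<open>v\<close> in different cells, both ends are moved to
  grid points by comparison with lines of slope \<open>B\<close>. Within one cell the increment is a fraction
  of that of the whole cell, and \<open>A\<close> is scaled down by that fraction; this is where \<open>0 \<le> A\<close>
  is used.
\<close>

lemma interp_increment_le:
  assumes A: "0 \<le> A"
    and V: "\<And>i j. i \<le> j \<Longrightarrow> V j - V i \<le> A + B * (\<tau> j - \<tau> i)"
    and uv: "0 \<le> u" "u \<le> v"
  shows "interp V v - interp V u \<le> A + B * (v - u)"
proof -
  have v0: "0 \<le> v" using uv by simp
  have from_grid: "interp V v \<le> (V g + A - B * \<tau> g) + B * v" if "g \<le> cell v" for g
    using that V[of g "cell v"] V[of g "Suc (cell v)"]
    by (intro interp_below_line v0) (auto simp: algebra_simps)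
  show ?thesis
  proof (cases "cell u = cell v")
    case False
    then have "cell u < cell v" using cell_mono[OF uv] by simp
    then have "(interp V v - A - B * v) + B * u \<le> interp V u"
      using from_grid[of "cell u"] from_grid[of "Suc (cell u)"]
      by (intro interp_above_line uv(1)) auto
    then show ?thesis by (simp add: algebra_simps)
  next
    case True
    define i where "i = cell v"
    define h where "h = \<tau> (Suc i) - \<tau> i"
    have h: "0 < h" "v - u \<le> h"
      using step_pos[of i] cell_lower[OF uv(1)] cell_upper[of v] True
      unfolding h_def i_def by auto
    have s: "slope V i \<le> A / h + B"
    proof -
      have "slope V i \<le> (A + B * h) / h"
        using V[of i "Suc i"] h(1) unfolding slope_def h_def[symmetric]
        by (intro divide_right_mono) auto
      then show ?thesis using h(1) by (simp add: add_divide_distrib)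
    qed
    have "interp V v - interp V u = slope V i * (v - u)"
      using True unfolding interp_def i_def by (simp add: algebra_simps)
    also have "\<dots> \<le> (A / h + B) * (v - u)" using s uv by (intro mult_right_mono) auto
    also have "\<dots> = A * ((v - u) / h) + B * (v - u)" by (simp add: algebra_simps)
    also have "\<dots> \<le> A * 1 + B * (v - u)"
      using A h uv by (intro add_mono mult_left_mono order_refl) auto
    finally show ?thesis by simp
  qed
qed

lemma grid_increment_le:
  assumes "\<And>i. V (Suc i) - V i \<le> B * (\<tau> (Suc i) - \<tau> i)" and "i \<le> j"
  shows "V j - V i \<le> B * (\<tau> j - \<tau> i)"
  using assms(2)
proof (induction rule: dec_induct)
  case (step n)
  then show ?case using assms(1)[of n] by (simp add: algebra_simps)
qed simp

lemma interp_increment_le_of_steps: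
  assumes "\<And>i. V (Suc i) - V i \<le> B * (\<tau> (Suc i) - \<tau> i)" and "0 \<le> u" "u \<le> v"
  shows "interp V v - interp V u \<le> B * (v - u)"
  using interp_increment_le[of 0 V B u v] grid_increment_le[OF assms(1)] assms(2,3) by simp

lemma interp_has_derivative:
  assumes "\<tau> i < t" "t < \<tau> (Suc i)"
  shows "(interp V has_real_derivative slope V i) (at t)"
proof -
  have "((\<lambda>t. V i + slope V i * (t - \<tau> i)) has_real_derivative slope V i) (at t)"
    by (auto intro!: derivative_eq_intros)
  then show ?thesis
  proof (rule has_field_derivative_transform_within_open)
    show "open {\<tau> i<..<\<tau> (Suc i)}" "t \<in> {\<tau> i<..<\<tau> (Suc i)}" using assms by auto
    show "V i + slope V i * (x - \<tau> i) = interp V x" if "x \<in> {\<tau> i<..<\<tau> (Suc i)}" for x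
      using that interp_on_cell[of i x V] by simp
  qed
qed

text \<open>
  An interpolation with nondecreasing slopes is convex up to \<open>\<tau> n\<close>.
\<close>

lemma interp_supporting_line:
  assumes inc: "\<And>i. Suc i < n \<Longrightarrow> slope V i \<le> slope V (Suc i)"
    and v: "0 \<le> v" "v < \<tau> n" and t: "0 \<le> t" "t \<le> \<tau> n"
  shows "interp V v + slope V (cell v) * (t - v) \<le> interp V t"
proof -
  define i where "i = cell v"
  define s where "s = slope V i"
  have "\<tau> i < \<tau> n" using cell_lower[OF v(1)] v(2) unfolding i_def by linarith
  then have i: "i < n" by (simp add: tau_less)
  have mono: "slope V a \<le> slope V b" if "a \<le> b" "b < n" for a b
    using that
  proof (induction rule: dec_induct)
    case (step k)
    then show ?case using inc[of k] by simp
  qed simp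
  have right: "V i + s * (\<tau> b - \<tau> i) \<le> V b" if "i \<le> b" "b \<le> n" for b
    using that
  proof (induction rule: dec_induct)
    case (step k)
    have "s * (\<tau> (Suc k) - \<tau> k) \<le> slope V k * (\<tau> (Suc k) - \<tau> k)"
      using mono[of i k] step step_pos[of k] unfolding s_def by (intro mult_right_mono) auto
    then show ?case using step slope_times_step[of V k] by (simp add: algebra_simps)
  qed simp
  have left: "V i + s * (\<tau> b - \<tau> i) \<le> V b" if "b \<le> i" for b
    using that
  proof (induction rule: inc_induct)
    case (step k)
    have "slope V k * (\<tau> (Suc k) - \<tau> k) \<le> s * (\<tau> (Suc k) - \<tau> k)"
      using mono[of k i] i step step_pos[of k] unfolding s_def by (intro mult_right_mono) auto
    then show ?case using step slope_times_step[of V k] by (simp add: algebra_simps)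
  qed simp
  have grid: "(V i - s * \<tau> i) + s * \<tau> b \<le> V b" if "b \<le> n" for b
    using right[of b] left[of b] that by (cases "b \<le> i") (auto simp: algebra_simps)
  have "(V i - s * \<tau> i) + s * t \<le> interp V t"
  proof (cases "t = \<tau> n")
    case True
    then show ?thesis using grid[of n] by (simp add: interp_tau)
  next
    case False
    then have "\<tau> (cell t) < \<tau> n" using cell_lower[OF t(1)] t(2) by linarith
    then show ?thesis using grid by (intro interp_above_line t(1)) (auto simp: tau_less)
  qed
  then show ?thesis unfolding interp_def[of V v] i_def[symmetric] s_def by (simp add: algebra_simps)
qed

end

text \<open>
  The grid continues beyond the largest element of \<open>A\<close> in unit steps, so that its cells cover
  the whole half line and no last cell needs special treatment.
\<close>

lemma finite_set_time_grid:
  fixes A :: "real set"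
  assumes "finite A" "\<And>x. x \<in> A \<Longrightarrow> 0 < x"
  shows "\<exists>\<tau>. time_grid \<tau> \<and> A = \<tau> ` {1..card A}"
  using assms
proof (induction rule: finite_linorder_max_induct)
  case empty
  have "time_grid real"
    by (standard) (auto simp: strict_mono_def reals_Archimedean2)
  then show ?case by auto
next
  case (insert b A)
  then obtain \<tau> where g: "time_grid \<tau>" and A: "A = \<tau> ` {1..card A}" by auto
  interpret time_grid \<tau> by (rule g)
  define k where "k = card A"
  define \<tau>' where "\<tau>' i = (if i \<le> k then \<tau> i else b + real (i - Suc k))" for i
  have bk: "\<tau> k < b"
  proof (cases "k = 0")
    case True
    then show ?thesis using insert.prems[of b] start by simp
  next
    case False
    then have "\<tau> k \<in> A" using A unfolding k_def by auto
    then show ?thesis using insert.hyps by simp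
  qed
  have "\<tau>' i < \<tau>' (Suc i)" for i
    using tau_less[of i "Suc i"] bk unfolding \<tau>'_def
    by (auto simp: not_le less_Suc_eq_le le_Suc_eq of_nat_diff)
  then have "strict_mono \<tau>'" by (simp add: strict_mono_Suc_iff)
  moreover have "\<tau>' 0 = 0" using start by (simp add: \<tau>'_def)
  moreover have "\<exists>i. t < \<tau>' i" for t
  proof -
    obtain n where "t - b < real n" using reals_Archimedean2 by blast
    then have "t < \<tau>' (Suc k + n)" by (simp add: \<tau>'_def)
    then show ?thesis by blast
  qed
  ultimately have "time_grid \<tau>'" by unfold_locales
  moreover have "insert b A = \<tau>' ` {1..card (insert b A)}"
  proof -
    have "card (insert b A) = Suc k" using insert.hyps unfolding k_def by (subst card_insert_disjoint) auto
    moreover have "\<tau>' ` {1..k} = \<tau> ` {1..k}" by (rule image_cong) (auto simp: \<tau>'_def)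
    moreover have "\<tau>' (Suc k) = b" by (simp add: \<tau>'_def)
    ultimately show ?thesis using A unfolding k_def[symmetric] by (simp add: atLeastAtMostSuc_conv)
  qed
  ultimately show ?case by blast
qed

section \<open>Absolutely continuous functions with nonnegative derivative\<close>

lemma absolutely_continuous_fun_on_subset:
  "absolutely_continuous_fun_on A f \<Longrightarrow> B \<subseteq> A \<Longrightarrow> absolutely_continuous_fun_on B f"
  unfolding absolutely_continuous_fun_on_def by (meson order_trans)

lemma division_of_real_intervalD:
  fixes D :: "real set set"
  assumes "D division_of U" "K \<in> D"
  obtains l u where "K = {l..u}" "l \<le> u" "Inf K = l" "Sup K = u" "K \<subseteq> U"
proof -
  obtain l u where "K = cbox l u" "K \<noteq> {}" "K \<subseteq> U"
    using division_ofD[OF assms(1)] assms(2) by metis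
  then show thesis using that[of l u] by auto
qed

text \<open>
  Away from \<open>N\<close>, a short interval around \<open>x\<close> satisfies \<open>g v - g u \<ge> - e (v - u)\<close>. The null
  set \<open>N\<close> is covered by an open set of small measure. Cousin's lemma yields a tagged division of
  \<open>{a..b}\<close> that is fine for the gauge made of these two: intervals tagged outside \<open>N\<close> lose at
  most \<open>e (b - a)\<close> in total, and those tagged in \<open>N\<close> have small total length, hence small total
  increment by absolute continuity.
\<close>

lemma absolutely_continuous_fun_on_nondecreasing:
  fixes g :: "real \<Rightarrow> real"
  assumes ac: "absolutely_continuous_fun_on {a..b} g" and ab: "a \<le> b" and N: "negligible N"
    and deriv: "\<And>x. x \<in> {a..b} - N \<Longrightarrow> \<exists>D\<ge>0. (g has_real_derivative D) (at x)"
  shows "g a \<le> g b"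
proof -
  have bound: "g a - g b \<le> e * (b - a + 1)" if e: "0 < e" for e
  proof -
    obtain \<delta> where \<delta>: "0 < \<delta>" and small:
      "\<And>D U. D division_of U \<Longrightarrow> U \<subseteq> {a..b} \<Longrightarrow> (\<Sum>k\<in>D. Sup k - Inf k) < \<delta>
        \<Longrightarrow> (\<Sum>k\<in>D. \<bar>g (Sup k) - g (Inf k)\<bar>) < e"
      using ac e unfolding absolutely_continuous_fun_on_def by meson
    have Nnull: "N \<in> null_sets lebesgue" using N by (simp add: negligible_iff_null_sets)
    then obtain G where G: "open G" "N \<subseteq> G" "(G - N) \<in> lmeasurable"
        "emeasure lebesgue (G - N) < ennreal \<delta>"
      using sets_lebesgue_outer_open[of N \<delta>] \<delta> by blast
    have "emeasure lebesgue G = emeasure lebesgue (G - N)"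
      using Nnull G(1) by (intro emeasure_Diff_null_set[symmetric]) auto
    then have "emeasure lebesgue G < ennreal \<delta>" using G(4) by simp
    moreover from this have Gm: "G \<in> lmeasurable"
      using G(1) by (auto simp: fmeasurable_def intro: order.strict_trans[OF _ ennreal_less_top])
    ultimately have Gs: "measure lebesgue G < \<delta>"
      by (simp add: emeasure_eq_measure2 ennreal_less_iff)
    have "\<exists>\<eta>>0. \<forall>u v. u \<le> x \<and> x \<le> v \<and> x - u < \<eta> \<and> v - x < \<eta> \<longrightarrow> - e * (v - u) \<le> g v - g u"
      if x: "x \<in> {a..b} - N" for x
    proof -
      obtain d where d: "0 \<le> d" "(g has_real_derivative d) (at x)" using deriv[OF x] by blast
      then have "(g has_derivative (\<lambda>h. d * h)) (at x)" by (simp add: has_field_derivative_def)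
      then obtain \<eta> where \<eta>: "0 < \<eta>"
        "\<And>y. \<bar>y - x\<bar> < \<eta> \<Longrightarrow> \<bar>g y - g x - d * (y - x)\<bar> \<le> e * \<bar>y - x\<bar>"
        using e unfolding has_derivative_at_alt by auto
      have "- e * (v - u) \<le> g v - g u" if "u \<le> x" "x \<le> v" "x - u < \<eta>" "v - x < \<eta>" for u v
      proof -
        have "\<bar>g v - g x - d * (v - x)\<bar> \<le> e * (v - x)" using \<eta>(2)[of v] that by simp
        moreover have "\<bar>g u - g x - d * (u - x)\<bar> \<le> e * (x - u)" using \<eta>(2)[of u] that by simp
        moreover have "0 \<le> d * (v - x)" "0 \<le> d * (x - u)" using d that by auto
        ultimately show ?thesis by (simp add: algebra_simps abs_le_iff)
      qed
      then show ?thesis using \<eta>(1) by blast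
    qed
    then obtain \<eta> where \<eta>: "\<And>x. x \<in> {a..b} - N \<Longrightarrow> 0 < \<eta> x"
      "\<And>x u v. x \<in> {a..b} - N \<Longrightarrow> u \<le> x \<Longrightarrow> x \<le> v \<Longrightarrow> x - u < \<eta> x \<Longrightarrow> v - x < \<eta> x
          \<Longrightarrow> - e * (v - u) \<le> g v - g u"
      by metis
    define \<gamma> where "\<gamma> x = (if x \<in> N then G else if x \<in> {a..b} then ball x (\<eta> x) else UNIV)" for x
    have "gauge \<gamma>" using G(1,2) \<eta>(1) unfolding gauge_def \<gamma>_def by auto
    then obtain p where p: "p tagged_division_of {a..b}" and fine: "\<gamma> fine p"
      using fine_division_exists_real by blast
    have finp: "finite p" using p by (rule tagged_division_of_finite)
    have pK: "\<exists>l u. K = {l..u} \<and> l \<le> x \<and> x \<le> u \<and> Inf K = l \<and> Sup K = u \<and> a \<le> l \<and> u \<le> b"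
      if xK: "(x, K) \<in> p" for x K
    proof -
      obtain l u where "K = cbox l u" "x \<in> K" "K \<subseteq> {a..b}"
        using tagged_division_ofD(2,3,4)[OF p xK] by metis
      then show ?thesis by (intro exI[of _ l] exI[of _ u]) auto
    qed
    define q where "q = {z \<in> p. fst z \<in> N}"
    have qp: "q \<subseteq> p" unfolding q_def by auto
    have len: "(\<Sum>(x,K)\<in>p. Sup K - Inf K) = b - a"
      using additive_tagged_division_1[OF ab p, of "\<lambda>x. x"] by simp
    have good: "- e * (b - a) \<le> (\<Sum>(x,K)\<in>p - q. g (Sup K) - g (Inf K))"
    proof -
      have "(\<Sum>(x,K)\<in>p - q. Sup K - Inf K) \<le> (\<Sum>(x,K)\<in>p. Sup K - Inf K)"
        using pK by (intro sum_mono2 finp) fastforce+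
      then have "- e * (b - a) \<le> - e * (\<Sum>(x,K)\<in>p - q. Sup K - Inf K)"
        using e len by simp
      also have "\<dots> = (\<Sum>(x,K)\<in>p - q. - e * (Sup K - Inf K))"
        by (simp add: sum_distrib_left case_prod_unfold)
      also have "\<dots> \<le> (\<Sum>(x,K)\<in>p - q. g (Sup K) - g (Inf K))"
      proof (rule sum_mono, clarify)
        fix x K assume xK: "(x, K) \<in> p" "(x, K) \<notin> q"
        then obtain l u where K: "K = {l..u}" "l \<le> x" "x \<le> u" "Inf K = l" "Sup K = u" "a \<le> l" "u \<le> b"
          using pK by blast
        have x: "x \<in> {a..b} - N" using xK K unfolding q_def by auto
        have sub: "K \<subseteq> ball x (\<eta> x)" using fine xK(1) x unfolding fine_def \<gamma>_def by force
        have "l \<in> K" "u \<in> K" using K by auto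
        then have "l \<in> ball x (\<eta> x)" "u \<in> ball x (\<eta> x)" using sub by blast+
        then show "- e * (Sup K - Inf K) \<le> g (Sup K) - g (Inf K)"
          using \<eta>(2)[OF x K(2,3)] K by (simp add: dist_real_def)
      qed
      finally show ?thesis .
    qed
    have bad: "- e \<le> (\<Sum>(x,K)\<in>q. g (Sup K) - g (Inf K))"
    proof -
      define D where "D = snd ` q"
      have "q tagged_partial_division_of {a..b}"
        using p qp unfolding tagged_division_of_def by (blast intro: tagged_partial_division_subset)
      then have D: "D division_of \<Union>D" and qU: "q tagged_division_of \<Union>D"
        unfolding D_def by (rule partial_division_of_tagged_division,
            rule tagged_partial_division_of_Union_self)
      have tag: "\<exists>x. (x, K) \<in> p \<and> x \<in> N" if "K \<in> D" for K
        using that unfolding D_def q_def by auto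
      have DU: "\<Union>D \<subseteq> {a..b}"
      proof (rule Union_least)
        fix K assume "K \<in> D"
        then obtain x where "(x, K) \<in> p" using tag by blast
        then show "K \<subseteq> {a..b}" by (rule tagged_division_ofD(3)[OF p])
      qed
      have DG: "\<Union>D \<subseteq> G"
      proof (rule Union_least)
        fix K assume KD: "K \<in> D"
        obtain x where x: "(x, K) \<in> p" "x \<in> N" using tag[OF KD] by auto
        have "K \<subseteq> \<gamma> x" by (rule fineD[OF fine x(1)])
        then show "K \<subseteq> G" using x(2) by (simp add: \<gamma>_def)
      qed
      have "(\<Sum>k\<in>D. Sup k - Inf k) = (\<Sum>k\<in>D. measure lebesgue k)"
        by (rule sum.cong) (auto elim!: division_of_real_intervalD[OF D])
      also have "\<dots> = measure lebesgue (\<Union>D)" by (rule content_division[OF D])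
      also have "\<dots> \<le> measure lebesgue G"
        using Gm DG lmeasurable_division[OF D] by (intro measure_mono_fmeasurable) auto
      finally have "(\<Sum>k\<in>D. \<bar>g (Sup k) - g (Inf k)\<bar>) < e"
        using small[OF D DU] Gs by simp
      \<comment> \<open>The case distinction makes the summand vanish on all degenerate boxes, the empty one
        included, so that sums over \<open>q\<close> and over its set of intervals agree.\<close>
      moreover have "(\<Sum>k\<in>D. \<bar>g (Sup k) - g (Inf k)\<bar>)
          = (\<Sum>k\<in>D. if k = {} then 0 else \<bar>g (Sup k) - g (Inf k)\<bar>)"
        by (rule sum.cong) (auto elim!: division_of_real_intervalD[OF D])
      moreover have "(\<Sum>(x,k)\<in>q. if k = {} then 0 else \<bar>g (Sup k) - g (Inf k)\<bar>)
          = (\<Sum>k\<in>D. if k = {} then 0 else \<bar>g (Sup k) - g (Inf k)\<bar>)"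
        unfolding D_def by (rule sum.over_tagged_division_lemma[OF qU]) auto
      moreover have "(\<Sum>(x,k)\<in>q. - (if k = {} then 0 else \<bar>g (Sup k) - g (Inf k)\<bar>))
          \<le> (\<Sum>(x,K)\<in>q. g (Sup K) - g (Inf K))"
      proof (rule sum_mono, clarify)
        fix x K assume "(x, K) \<in> q"
        then have "x \<in> K" by (rule tagged_division_ofD(2)[OF qU])
        then show "- (if K = {} then 0 else \<bar>g (Sup K) - g (Inf K)\<bar>) \<le> g (Sup K) - g (Inf K)"
          by auto
      qed
      ultimately show ?thesis by (simp add: sum_negf case_prod_unfold)
    qed
    have "g b - g a = (\<Sum>(x,K)\<in>p. g (Sup K) - g (Inf K))"
      by (rule additive_tagged_division_1[OF ab p, symmetric])
    also have "\<dots> = (\<Sum>(x,K)\<in>p - q. g (Sup K) - g (Inf K)) + (\<Sum>(x,K)\<in>q. g (Sup K) - g (Inf K))"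
      by (rule sum.subset_diff[OF qp finp])
    finally show ?thesis using good bad by (simp add: algebra_simps)
  qed
  have "g a - g b \<le> 0 + e" if "0 < e" for e
    using bound[of "e / (b - a + 1)"] that ab by simp
  then have "g a - g b \<le> 0" by (rule field_le_epsilon)
  then show ?thesis by simp
qed

lemma lipschitz_absolutely_continuous_fun_on:
  fixes f :: "real \<Rightarrow> real"
  assumes lip: "\<And>x y. x \<in> A \<Longrightarrow> y \<in> A \<Longrightarrow> x \<le> y \<Longrightarrow> \<bar>f y - f x\<bar> \<le> L * (y - x)"
  shows "absolutely_continuous_fun_on A f"
  unfolding absolutely_continuous_fun_on_def
proof (intro allI impI)
  fix e :: real assume e: "0 < e"
  show "\<exists>\<delta>>0. \<forall>D U. D division_of U \<and> U \<subseteq> A \<and> (\<Sum>k\<in>D. Sup k - Inf k) < \<delta>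
        \<longrightarrow> (\<Sum>k\<in>D. \<bar>f (Sup k) - f (Inf k)\<bar>) < e"
  proof (intro exI[of _ "e / (\<bar>L\<bar> + 1)"] conjI allI impI)
    show "0 < e / (\<bar>L\<bar> + 1)" using e by simp
  next
    fix D U assume D: "D division_of U \<and> U \<subseteq> A \<and> (\<Sum>k\<in>D. Sup k - Inf k) < e / (\<bar>L\<bar> + 1)"
    then have div: "D division_of U" by simp
    have "(\<Sum>k\<in>D. \<bar>f (Sup k) - f (Inf k)\<bar>) \<le> (\<Sum>k\<in>D. (\<bar>L\<bar> + 1) * (Sup k - Inf k))"
    proof (rule sum_mono)
      fix k assume "k \<in> D"
      then obtain l u where k: "k = {l..u}" "l \<le> u" "Inf k = l" "Sup k = u" "k \<subseteq> U"
        by (rule division_of_real_intervalD[OF div])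
      then have "\<bar>f u - f l\<bar> \<le> L * (u - l)" using D by (intro lip) auto
      also have "\<dots> \<le> (\<bar>L\<bar> + 1) * (u - l)" using k by (intro mult_right_mono) auto
      finally show "\<bar>f (Sup k) - f (Inf k)\<bar> \<le> (\<bar>L\<bar> + 1) * (Sup k - Inf k)" using k by simp
    qed
    also have "\<dots> = (\<bar>L\<bar> + 1) * (\<Sum>k\<in>D. Sup k - Inf k)" by (simp add: sum_distrib_left)
    also have "\<dots> < e" using D by (simp add: field_simps)
    finally show "(\<Sum>k\<in>D. \<bar>f (Sup k) - f (Inf k)\<bar>) < e" .
  qed
qed

lemma absolutely_continuous_fun_on_diff:
  assumes "absolutely_continuous_fun_on A f" "absolutely_continuous_fun_on A g"
  shows "absolutely_continuous_fun_on A (\<lambda>x. f x - g x)"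
  unfolding absolutely_continuous_fun_on_def
proof (intro allI impI)
  fix e :: real assume e: "0 < e"
  obtain d1 where d1: "0 < d1" "\<And>D U. D division_of U \<Longrightarrow> U \<subseteq> A \<Longrightarrow> (\<Sum>k\<in>D. Sup k - Inf k) < d1
        \<Longrightarrow> (\<Sum>k\<in>D. \<bar>f (Sup k) - f (Inf k)\<bar>) < e / 2"
    using assms(1) e unfolding absolutely_continuous_fun_on_def by (meson half_gt_zero)
  obtain d2 where d2: "0 < d2" "\<And>D U. D division_of U \<Longrightarrow> U \<subseteq> A \<Longrightarrow> (\<Sum>k\<in>D. Sup k - Inf k) < d2
        \<Longrightarrow> (\<Sum>k\<in>D. \<bar>g (Sup k) - g (Inf k)\<bar>) < e / 2"
    using assms(2) e unfolding absolutely_continuous_fun_on_def by (meson half_gt_zero)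
  show "\<exists>\<delta>>0. \<forall>D U. D division_of U \<and> U \<subseteq> A \<and> (\<Sum>k\<in>D. Sup k - Inf k) < \<delta>
        \<longrightarrow> (\<Sum>k\<in>D. \<bar>(f (Sup k) - g (Sup k)) - (f (Inf k) - g (Inf k))\<bar>) < e"
  proof (intro exI[of _ "min d1 d2"] conjI allI impI)
    show "0 < min d1 d2" using d1 d2 by simp
  next
    fix D U assume D: "D division_of U \<and> U \<subseteq> A \<and> (\<Sum>k\<in>D. Sup k - Inf k) < min d1 d2"
    have "(\<Sum>k\<in>D. \<bar>(f (Sup k) - g (Sup k)) - (f (Inf k) - g (Inf k))\<bar>)
        \<le> (\<Sum>k\<in>D. \<bar>f (Sup k) - f (Inf k)\<bar> + \<bar>g (Sup k) - g (Inf k)\<bar>)"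
      by (intro sum_mono) linarith
    also have "\<dots> < e / 2 + e / 2"
      unfolding sum.distrib using D d1(2)[of D U] d2(2)[of D U] by (intro add_strict_mono) auto
    finally show "(\<Sum>k\<in>D. \<bar>(f (Sup k) - g (Sup k)) - (f (Inf k) - g (Inf k))\<bar>) < e" by simp
  qed
qed

section \<open>Temperatures\<close>

lemma AE_lebesgue_off_negligible:
  assumes "AE t in lebesgue. P t"
  obtains N where "negligible N" "\<And>t. t \<notin> N \<Longrightarrow> P t"
proof -
  have "{t. \<not> P t} \<in> null_sets lebesgue"
    using assms by (simp add: completion.AE_iff_null_sets)
  then have "negligible {t. \<not> P t}" by (simp only: negligible_iff_null_sets)
  then show thesis by (rule that) simp
qed

text \<open>
  Reflection at \<open>0\<close> only adds heat, so the temperature rises at least as fast as the unreflected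
  drift.
\<close>

lemma temperature_increase_ge_drift:
  assumes T: "is_temperature \<alpha> \<beta> s T" and P: "finite P"
    and W: "\<And>t. 0 < t \<Longrightarrow> t < b \<Longrightarrow> t \<notin> P \<Longrightarrow> (W has_real_derivative s t) (at t)"
    and lip: "\<And>x y. 0 \<le> x \<Longrightarrow> x \<le> y \<Longrightarrow> y \<le> b \<Longrightarrow> \<bar>W y - W x\<bar> \<le> L * (y - x)"
    and uv: "0 \<le> u" "u \<le> v" "v \<le> b"
  shows "(\<beta> - \<alpha>) * (W v - W u) + \<alpha> * (v - u) \<le> T v - T u"
proof -
  obtain N where N: "negligible N"
    "\<And>t. t \<notin> N \<Longrightarrow> 0 < t \<Longrightarrow> (T has_real_derivative heat_rate \<alpha> \<beta> (s t) (T t)) (at t)"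
  proof -
    have "AE t in lebesgue. 0 < t \<longrightarrow> (T has_real_derivative heat_rate \<alpha> \<beta> (s t) (T t)) (at t)"
      using T by (simp add: is_temperature_def)
    then show thesis by (rule AE_lebesgue_off_negligible) (use that in blast)
  qed
  define X where "X t = (\<beta> - \<alpha>) * W t + \<alpha> * t" for t
  have Xlip: "\<bar>X y - X x\<bar> \<le> (\<bar>\<beta> - \<alpha>\<bar> * L + \<bar>\<alpha>\<bar>) * (y - x)"
    if "x \<in> {u..v}" "y \<in> {u..v}" "x \<le> y" for x y
  proof -
    have "X y - X x = (\<beta> - \<alpha>) * (W y - W x) + \<alpha> * (y - x)" by (simp add: X_def algebra_simps)
    then have "\<bar>X y - X x\<bar> \<le> \<bar>(\<beta> - \<alpha>) * (W y - W x)\<bar> + \<bar>\<alpha> * (y - x)\<bar>"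
      by (metis abs_triangle_ineq)
    also have "\<dots> = \<bar>\<beta> - \<alpha>\<bar> * \<bar>W y - W x\<bar> + \<bar>\<alpha>\<bar> * (y - x)"
      using that by (simp add: abs_mult)
    also have "\<dots> \<le> \<bar>\<beta> - \<alpha>\<bar> * (L * (y - x)) + \<bar>\<alpha>\<bar> * (y - x)"
      using that uv by (intro add_mono mult_left_mono lip) auto
    finally show ?thesis by (simp add: algebra_simps)
  qed
  have "T u - X u \<le> T v - X v"
  proof (rule absolutely_continuous_fun_on_nondecreasing[where g = "\<lambda>t. T t - X t" and a = u and b = v
        and N = "N \<union> insert u (insert v P)"])
    have "absolutely_continuous_fun_on {0..v} T"
      using T uv unfolding is_temperature_def by auto
    then have "absolutely_continuous_fun_on {u..v} T"
      by (rule absolutely_continuous_fun_on_subset) (use uv in auto)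
    then show "absolutely_continuous_fun_on {u..v} (\<lambda>t. T t - X t)"
      by (rule absolutely_continuous_fun_on_diff)
        (rule lipschitz_absolutely_continuous_fun_on[OF Xlip])
    show "negligible (N \<union> insert u (insert v P))"
      using P by (intro negligible_Un N(1) negligible_finite) simp
    fix t assume "t \<in> {u..v} - (N \<union> insert u (insert v P))"
    then have t: "u < t" "t < v" "t \<notin> N" "t \<notin> P" by auto
    have "(X has_real_derivative (\<beta> - \<alpha>) * s t + \<alpha>) (at t)"
      unfolding X_def using W[of t] t uv by (auto intro!: derivative_eq_intros)
    with N(2)[of t] have "((\<lambda>t. T t - X t) has_real_derivative
        heat_rate \<alpha> \<beta> (s t) (T t) - ((\<beta> - \<alpha>) * s t + \<alpha>)) (at t)"
      using t uv by (auto intro!: derivative_intros)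
    moreover have "0 \<le> heat_rate \<alpha> \<beta> (s t) (T t) - ((\<beta> - \<alpha>) * s t + \<alpha>)"
      by (auto simp: heat_rate_def algebra_simps)
    ultimately show "\<exists>D\<ge>0. ((\<lambda>t. T t - X t) has_real_derivative D) (at t)" by blast
  qed (use uv in auto)
  then show ?thesis by (simp add: X_def algebra_simps)
qed

context time_grid
begin

lemma interp_lipschitz:
  assumes "\<And>i. \<bar>slope X i\<bar> \<le> L" and "0 \<le> u" "u \<le> v"
  shows "\<bar>interp X v - interp X u\<bar> \<le> L * (v - u)"
proof -
  have step: "\<bar>X (Suc i) - X i\<bar> \<le> L * (\<tau> (Suc i) - \<tau> i)" for i
  proof -
    have "\<bar>X (Suc i) - X i\<bar> = \<bar>slope X i * (\<tau> (Suc i) - \<tau> i)\<bar>" by (simp only: slope_times_step)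
    also have "\<dots> = \<bar>slope X i\<bar> * (\<tau> (Suc i) - \<tau> i)" using step_pos[of i] by (simp add: abs_mult)
    also have "\<dots> \<le> L * (\<tau> (Suc i) - \<tau> i)" using assms(1)[of i] step_pos[of i] by (intro mult_right_mono) auto
    finally show ?thesis .
  qed
  have "interp X v - interp X u \<le> L * (v - u)"
    using step assms(2,3) by (intro interp_increment_le_of_steps) (auto simp: abs_le_iff)
  moreover have "interp (\<lambda>i. - X i) v - interp (\<lambda>i. - X i) u \<le> L * (v - u)"
    using step assms(2,3) by (intro interp_increment_le_of_steps) (auto simp: abs_le_iff)
  ultimately show ?thesis by (simp add: interp_uminus)
qed

lemma interp_continuous_on:
  assumes "\<And>i. \<bar>slope X i\<bar> \<le> L"
  shows "continuous_on {0..} (interp X)"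
proof (rule lipschitz_on_continuous_on)
  show "\<bar>L\<bar>-lipschitz_on {0..} (interp X)"
  proof (rule lipschitz_onI)
    fix x y :: real assume "x \<in> {0..}" "y \<in> {0..}"
    then have "dist (interp X x) (interp X y) \<le> L * dist x y"
      using interp_lipschitz[OF assms, of x y] interp_lipschitz[OF assms, of y x]
      by (cases "x \<le> y") (auto simp: dist_real_def)
    also have "\<dots> \<le> \<bar>L\<bar> * dist x y" by (intro mult_right_mono) auto
    finally show "dist (interp X x) (interp X y) \<le> \<bar>L\<bar> * dist x y" .
  qed simp
qed

lemma slope_has_integral:
  assumes "\<And>i. \<bar>slope X i\<bar> \<le> L" and t: "0 \<le> t"
  shows "((\<lambda>x. slope X (cell x)) has_integral interp X t - X 0) {0..t}"
proof -
  have "((\<lambda>x. slope X (cell x)) has_integral interp X t - interp X 0) {0..t}"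
  proof (rule fundamental_theorem_of_calculus_interior_strong[where S = "\<tau> ` {..cell t}"])
    show "continuous_on {0..t} (interp X)"
      by (rule continuous_on_subset[OF interp_continuous_on[OF assms(1)]]) auto
    fix x assume x: "x \<in> {0<..<t} - \<tau> ` {..cell t}"
    then have "cell x \<le> cell t" by (intro cell_mono) auto
    then have "x \<noteq> \<tau> (cell x)" using x by auto
    then have "\<tau> (cell x) < x" using cell_lower[of x] x by auto
    then show "(interp X has_vector_derivative slope X (cell x)) (at x)"
      using interp_has_derivative[of "cell x" x X] cell_upper[of x]
      by (simp add: has_real_derivative_iff_has_vector_derivative)
  qed (use t in auto)
  then show ?thesis using interp_tau[of X 0] by (simp add: start)
qed

text \<open>
  The solution of the reflection (Skorokhod) problem at \<open>0\<close> for the driving function \<open>interp X\<close>.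
\<close>

definition reflected :: "(nat \<Rightarrow> real) \<Rightarrow> real \<Rightarrow> real" where
  "reflected X t = interp X t - Inf (interp X ` {0..t})"

context
  fixes X :: "nat \<Rightarrow> real" and L :: real
  assumes slopes: "\<And>i. \<bar>slope X i\<bar> \<le> L"
begin

lemma L_nonneg: "0 \<le> L"
  using slopes[of 0] by linarith

lemma running_inf_le:
  assumes "0 \<le> x" "x \<le> t" shows "Inf (interp X ` {0..t}) \<le> interp X x"
proof (rule cInf_lower)
  have "interp X 0 - L * t \<le> interp X y" if "0 \<le> y" "y \<le> t" for y
  proof -
    have "\<bar>interp X y - interp X 0\<bar> \<le> L * (y - 0)" by (rule interp_lipschitz[OF slopes]) (use that in auto)
    moreover have "L * y \<le> L * t" using that L_nonneg by (intro mult_left_mono) auto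
    ultimately show ?thesis by (simp add: abs_le_iff)
  qed
  then show "bdd_below (interp X ` {0..t})" by (auto intro!: bdd_belowI[of _ "interp X 0 - L * t"])
qed (use assms in auto)

lemma running_inf_ge:
  assumes "0 \<le> t" "\<And>x. 0 \<le> x \<Longrightarrow> x \<le> t \<Longrightarrow> c \<le> interp X x"
  shows "c \<le> Inf (interp X ` {0..t})"
  by (rule cInf_greatest) (use assms in auto)

text \<open>
  An affine function on a cell attains its minimum at one of the two ends, and the value at the
  left end is already covered by the earlier infimum.
\<close>

lemma running_inf_on_cell:
  assumes t: "\<tau> i \<le> t" "t \<le> \<tau> (Suc i)"
  shows "Inf (interp X ` {0..t}) = min (Inf (interp X ` {0..\<tau> i})) (interp X t)" (is "?M t = _")
proof (rule antisym)
  have t0: "0 \<le> t" using t tau_nonneg[of i] by linarith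
  show "?M t \<le> min (?M (\<tau> i)) (interp X t)"
    using t t0 tau_nonneg[of i] by (auto intro!: running_inf_ge intro: running_inf_le)
  show "min (?M (\<tau> i)) (interp X t) \<le> ?M t"
  proof (rule running_inf_ge[OF t0])
    fix x assume x: "0 \<le> x" "x \<le> t"
    show "min (?M (\<tau> i)) (interp X t) \<le> interp X x"
    proof (cases "x \<le> \<tau> i")
      case True
      then show ?thesis using running_inf_le[of x "\<tau> i"] x by auto
    next
      case False
      then have xi: "interp X x = X i + slope X i * (x - \<tau> i)"
        using x t by (intro interp_on_cell) auto
      have ti: "interp X t = X i + slope X i * (t - \<tau> i)"
        using t by (intro interp_on_cell) auto
      have Mi: "?M (\<tau> i) \<le> X i" using running_inf_le[of "\<tau> i" "\<tau> i"] tau_nonneg[of i] by (simp add: interp_tau)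
      show ?thesis
      proof (cases "0 \<le> slope X i")
        case True
        then have "X i \<le> interp X x" using False unfolding xi by simp
        then show ?thesis using Mi by linarith
      next
        case neg: False
        then have "interp X t \<le> interp X x" unfolding xi ti
          using x by (simp add: mult_left_mono_neg)
        then show ?thesis by linarith
      qed
    qed
  qed
qed

lemma reflected_nonneg: "0 \<le> t \<Longrightarrow> 0 \<le> reflected X t"
  using running_inf_le[of t t] by (simp add: reflected_def)

lemma reflected_le:
  assumes "0 \<le> t" "\<And>x. 0 \<le> x \<Longrightarrow> x \<le> t \<Longrightarrow> interp X t - interp X x \<le> c"
  shows "reflected X t \<le> c"
  using running_inf_ge[of t "interp X t - c"] assms by (force simp: reflected_def)

lemma reflected_lipschitz:
  assumes "0 \<le> u" "u \<le> v"
  shows "\<bar>reflected X v - reflected X u\<bar> \<le> 2 * L * (v - u)"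
proof -
  have "Inf (interp X ` {0..u}) - L * (v - u) \<le> Inf (interp X ` {0..v})"
  proof (rule running_inf_ge)
    fix x assume x: "0 \<le> x" "x \<le> v"
    show "Inf (interp X ` {0..u}) - L * (v - u) \<le> interp X x"
    proof (cases "x \<le> u")
      case True
      moreover have "0 \<le> L * (v - u)" using L_nonneg assms by simp
      ultimately show ?thesis using running_inf_le[of x u] x by linarith
    next
      case False
      then have "\<bar>interp X x - interp X u\<bar> \<le> L * (x - u)"
        using assms by (intro interp_lipschitz[OF slopes]) auto
      moreover have "L * (x - u) \<le> L * (v - u)" using x L_nonneg by (intro mult_left_mono) auto
      moreover have "Inf (interp X ` {0..u}) \<le> interp X u" using running_inf_le[of u u] assms by simp
      ultimately show ?thesis by (simp add: abs_le_iff)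
    qed
  qed (use assms in auto)
  moreover have "Inf (interp X ` {0..v}) \<le> Inf (interp X ` {0..u})"
    using assms by (intro running_inf_ge running_inf_le) auto
  moreover have "\<bar>interp X v - interp X u\<bar> \<le> L * (v - u)"
    using interp_lipschitz[OF slopes assms] .
  ultimately show ?thesis unfolding reflected_def abs_le_iff
    by (simp add: mult.assoc)
qed

text \<open>
  Within a cell the reflected path is \<open>max (interp X t - M) 0\<close> for the infimum \<open>M\<close> reached before
  the cell. Only the single time at which a falling path hits \<open>0\<close> has to be excluded.
\<close>

lemma reflected_has_derivative:
  assumes t: "\<tau> i < t" "t < \<tau> (Suc i)"
    and hit: "slope X i < 0 \<Longrightarrow> interp X t \<noteq> Inf (interp X ` {0..\<tau> i})"
  shows "(reflected X has_real_derivative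
          (if 0 < reflected X t then slope X i else max 0 (slope X i))) (at t)"
proof -
  define M where "M = Inf (interp X ` {0..\<tau> i})"
  have refl: "reflected X y = max (interp X y - M) 0" if "y \<in> {\<tau> i<..<\<tau> (Suc i)}" for y
    using running_inf_on_cell[of i y] that unfolding reflected_def M_def by (simp add: min_def max_def)
  have cell: "interp X y = X i + slope X i * (y - \<tau> i)" if "y \<in> {\<tau> i<..<\<tau> (Suc i)}" for y
    using that by (intro interp_on_cell) auto
  have D: "((\<lambda>y. X i + slope X i * (y - \<tau> i) - M) has_real_derivative slope X i) (at t)"
    by (auto intro!: derivative_eq_intros)
  have Mi: "M \<le> X i"
    using running_inf_le[of "\<tau> i" "\<tau> i"] tau_nonneg[of i] by (simp add: interp_tau M_def)
  show ?thesis
  proof (cases "0 \<le> slope X i")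
    case True
    have "(reflected X has_real_derivative slope X i) (at t)"
    proof (rule has_field_derivative_transform_within_open[OF D])
      show "X i + slope X i * (y - \<tau> i) - M = reflected X y" if "y \<in> {\<tau> i<..<\<tau> (Suc i)}" for y
      proof -
        have "0 \<le> slope X i * (y - \<tau> i)" using that True by simp
        then show ?thesis using Mi unfolding refl[OF that] cell[OF that] by simp
      qed
    qed (use t in auto)
    then show ?thesis using True by simp
  next
    case False
    have op: "open ({\<tau> i<..<\<tau> (Suc i)} \<inter> {y. M < X i + slope X i * (y - \<tau> i)})"
      "open ({\<tau> i<..<\<tau> (Suc i)} \<inter> {y. X i + slope X i * (y - \<tau> i) < M})"
      by (auto intro!: open_Int open_Collect_less continuous_intros)
    consider "M < interp X t" | "interp X t < M" using hit False unfolding M_def by force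
    then show ?thesis
    proof cases
      case 1
      have "(reflected X has_real_derivative slope X i) (at t)"
        by (rule has_field_derivative_transform_within_open[OF D op(1)])
          (use 1 t cell refl in auto)
      then show ?thesis using 1 refl[of t] t by simp
    next
      case 2
      have "((\<lambda>y. 0) has_real_derivative 0) (at t)" by simp
      then have "(reflected X has_real_derivative 0) (at t)"
        by (rule has_field_derivative_transform_within_open[OF _ op(2)])
          (use 2 t cell refl in auto)
      then show ?thesis using 2 refl[of t] t False by simp
    qed
  qed
qed

lemma reflected_is_temperature:
  assumes s: "\<And>i. slope X i = \<alpha> * (1 - s i) + \<beta> * s i"
  shows "is_temperature \<alpha> \<beta> (\<lambda>t. s (cell t)) (reflected X)"
proof -
  \<comment> \<open>Grid times, and for each cell the time at which its affine piece hits the earlier infimum.\<close>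
  define E where "E = range \<tau> \<union> range (\<lambda>i. \<tau> i + (Inf (interp X ` {0..\<tau> i}) - X i) / slope X i)"
  have "countable E" unfolding E_def by auto
  then have "E \<in> null_sets lebesgue"
    by (intro null_sets_completionI countable_imp_null_set_lborel)
  then have "AE t in lebesgue. t \<notin> E" by (rule AE_not_in)
  then have "AE t in lebesgue. 0 < t \<longrightarrow>
    (reflected X has_real_derivative heat_rate \<alpha> \<beta> (s (cell t)) (reflected X t)) (at t)"
  proof (rule AE_mp, intro AE_I2 impI)
    fix t :: real assume tE: "t \<notin> E" and t: "0 < t"
    define i where "i = cell t"
    have i: "\<tau> i < t" "t < \<tau> (Suc i)"
    proof -
      have "t \<noteq> \<tau> i" using tE unfolding E_def by blast
      then show "\<tau> i < t" using cell_lower[of t] t unfolding i_def by simp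
      show "t < \<tau> (Suc i)" unfolding i_def by (rule cell_upper)
    qed
    have "interp X t \<noteq> Inf (interp X ` {0..\<tau> i})" if "slope X i < 0"
    proof
      assume "interp X t = Inf (interp X ` {0..\<tau> i})"
      then have "X i + slope X i * (t - \<tau> i) = Inf (interp X ` {0..\<tau> i})"
        using interp_on_cell[of i t X] i by simp
      then have "t = \<tau> i + (Inf (interp X ` {0..\<tau> i}) - X i) / slope X i"
        using that by (auto simp: field_simps)
      then show False using tE unfolding E_def by blast
    qed
    from reflected_has_derivative[OF i this]
    show "(reflected X has_real_derivative heat_rate \<alpha> \<beta> (s (cell t)) (reflected X t)) (at t)"
      unfolding heat_rate_def s i_def by simp
  qed
  moreover have "absolutely_continuous_fun_on {0..b} (reflected X)" for b
    by (rule lipschitz_absolutely_continuous_fun_on) (auto intro: reflected_lipschitz)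
  moreover have "reflected X 0 = 0" by (simp add: reflected_def)
  ultimately show ?thesis unfolding is_temperature_def using reflected_nonneg by simp
qed

end

end

section \<open>Work profiles and optimal deadlines\<close>

lemma compact_coordinatewise:
  fixes A :: "'i \<Rightarrow> 'a::topological_space set"
  assumes "\<And>i. compact (A i)" shows "compact {f. \<forall>i. f i \<in> A i}"
proof -
  have "compactin (product_topology (\<lambda>_. euclidean) UNIV) (PiE UNIV A)"
    unfolding compactin_PiE using assms by simp
  moreover have "PiE UNIV A = {f. \<forall>i. f i \<in> A i}" by (auto simp: PiE_def)
  ultimately show ?thesis by (simp add: euclidean_product_topology)
qed

text \<open>
  The heating and cooling rates enter only through \<open>\<sigma>\<close>, the load that keeps the temperature
  constant, and \<open>H\<close>, the work beyond the rate \<open>\<sigma>\<close> that heats a job from \<open>0\<close> to \<open>1\<close>.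
\<close>

locale cooled_jobs =
  fixes J :: "'j set" and m \<sigma> H :: real and p :: "'j \<Rightarrow> real"
  assumes finite_J: "finite J" and m_ge: "1 \<le> m"
    and \<sigma>_pos: "0 < \<sigma>" and \<sigma>_less: "\<sigma> < 1" and H_pos: "0 < H"
    and p_pos: "\<And>j. j \<in> J \<Longrightarrow> 0 < p j"
begin

text \<open>
  The work functions of feasible schedules. Loads are not mentioned: all conditions are closed
  conditions on values of \<open>W\<close>, which makes compactness available. The bound with \<open>H\<close> is the
  temperature bound.
\<close>

definition profile :: "('j \<Rightarrow> real \<Rightarrow> real) \<Rightarrow> bool" where
  "profile W \<longleftrightarrow>
     (\<forall>j\<in>J. W j 0 = 0 \<and> (\<forall>u v. 0 \<le> u \<and> u \<le> v \<longrightarrow>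
        W j u \<le> W j v \<and> W j v - W j u \<le> v - u \<and> W j v - W j u \<le> H + \<sigma> * (v - u))) \<and>
     (\<forall>u v. 0 \<le> u \<and> u \<le> v \<longrightarrow> (\<Sum>j\<in>J. W j v - W j u) \<le> m * (v - u))"

definition plan :: "('j \<Rightarrow> real) \<Rightarrow> ('j \<Rightarrow> real \<Rightarrow> real) \<Rightarrow> bool" where
  "plan d W \<longleftrightarrow> profile W \<and> (\<forall>j\<in>J. 0 \<le> d j \<and> p j \<le> W j (d j))"

lemma
  assumes "profile W" "j \<in> J"
  shows profile_0: "W j 0 = 0"
    and profile_mono: "0 \<le> u \<Longrightarrow> u \<le> v \<Longrightarrow> W j u \<le> W j v"
    and profile_lip: "0 \<le> u \<Longrightarrow> u \<le> v \<Longrightarrow> W j v - W j u \<le> v - u"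
    and profile_window: "0 \<le> u \<Longrightarrow> u \<le> v \<Longrightarrow> W j v - W j u \<le> H + \<sigma> * (v - u)"
  using assms unfolding profile_def by blast+

lemma profile_total:
  assumes "profile W" "0 \<le> u" "u \<le> v"
  shows "(\<Sum>j\<in>J. W j v - W j u) \<le> m * (v - u)"
  using assms unfolding profile_def by blast

lemma profile_cong:
  assumes "\<And>j t. j \<in> J \<Longrightarrow> 0 \<le> t \<Longrightarrow> W j t = W' j t"
  shows "profile W \<longleftrightarrow> profile W'"
  using assms unfolding profile_def by (auto cong: sum.cong)

lemma plan_cong:
  assumes "\<And>j. j \<in> J \<Longrightarrow> d j = d' j" "\<And>j t. j \<in> J \<Longrightarrow> 0 \<le> t \<Longrightarrow> W j t = W' j t"
  shows "plan d W \<longleftrightarrow> plan d' W'"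
  using assms profile_cong[of W W'] unfolding plan_def by auto

lemma plan_deadline_ge:
  assumes "plan d W" "j \<in> J" shows "p j \<le> d j"
  using assms profile_lip[of W j 0 "d j"] profile_0[of W j] unfolding plan_def by force

lemma plan_exists: "\<exists>d W. plan d W"
proof -
  \<comment> \<open>At constant load \<open>c\<close> no job ever warms up, and one machine can serve all jobs.\<close>
  define c where "c = min \<sigma> (1 / (1 + real (card J)))"
  have c: "0 < c" "c \<le> \<sigma>" "c * (1 + real (card J)) \<le> 1"
    using \<sigma>_pos mult_right_mono[of c "1 / (1 + real (card J))" "1 + real (card J)"]
    unfolding c_def by (auto simp: min_def)
  have "real (card J) * c \<le> m" using c m_ge by (simp add: algebra_simps)
  have "plan (\<lambda>j. p j / c) (\<lambda>j t. c * t)"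
    unfolding plan_def profile_def
  proof (intro conjI ballI allI impI)
    fix u v :: real assume uv: "0 \<le> u \<and> u \<le> v"
    show "c * u \<le> c * v" using c uv by simp
    have e: "c * v - c * u = c * (v - u)" by (simp add: algebra_simps)
    have "c * (v - u) \<le> 1 * (v - u)" "c * (v - u) \<le> \<sigma> * (v - u)"
      using mult_right_mono[of c 1 "v - u"] mult_right_mono[of c \<sigma> "v - u"] c \<sigma>_less uv by auto
    then show "c * v - c * u \<le> v - u" "c * v - c * u \<le> H + \<sigma> * (v - u)"
      using H_pos unfolding e by auto
    have "real (card J) * c * (v - u) \<le> m * (v - u)"
      using \<open>real (card J) * c \<le> m\<close> uv by (intro mult_right_mono) auto
    then show "(\<Sum>j\<in>J. c * v - c * u) \<le> m * (v - u)" unfolding e by (simp add: mult.assoc)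
  qed (use c p_pos in \<open>auto simp: less_imp_le\<close>)
  then show ?thesis by blast
qed

text \<open>
  The bounds are imposed on all arguments, also on indices outside \<open>J\<close> and on negative times,
  because compactness concerns total functions.
\<close>

definition boxed_plans :: "real \<Rightarrow> (('j \<Rightarrow> real) \<times> ('j \<Rightarrow> real \<Rightarrow> real)) set" where
  "boxed_plans B = {(d, W). plan d W \<and> (\<forall>j. d j \<in> {0..B}) \<and> (\<forall>j t. W j t \<in> {0..\<bar>t\<bar>})}"

text \<open>
  The left side depends on \<open>W\<close> and \<open>d\<close> through the evaluation \<open>W j d\<close>, which is not continuous
  for pointwise convergence. The right side only involves values of \<open>W\<close> at fixed times; it is
  equivalent since \<open>W j\<close> is 1-Lipschitz.
\<close>

lemma deadline_met_iff:
  assumes "profile W" "j \<in> J" "0 \<le> d"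
  shows "p j \<le> W j d \<longleftrightarrow> (\<forall>t\<ge>0. p j \<le> W j t + \<bar>t - d\<bar>)"
proof
  assume pd: "p j \<le> W j d"
  show "\<forall>t\<ge>0. p j \<le> W j t + \<bar>t - d\<bar>"
  proof (intro allI impI)
    fix t :: real assume "0 \<le> t"
    then show "p j \<le> W j t + \<bar>t - d\<bar>"
      using pd assms profile_lip[OF assms(1,2), of t d] profile_mono[OF assms(1,2), of d t]
      by (cases "t \<le> d") auto
  qed
next
  assume "\<forall>t\<ge>0. p j \<le> W j t + \<bar>t - d\<bar>"
  then show "p j \<le> W j d" using assms(3) by (metis abs_zero add.right_neutral diff_self)
qed

lemma continuous_on_work_value:
  "continuous_on UNIV (\<lambda>x::('j \<Rightarrow> real) \<times> ('j \<Rightarrow> real \<Rightarrow> real). snd x j t)"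
proof -
  have "continuous_on UNIV (snd :: ('j \<Rightarrow> real) \<times> ('j \<Rightarrow> real \<Rightarrow> real) \<Rightarrow> _)"
    by (rule continuous_on_snd[OF continuous_on_id])
  from continuous_on_product_then_coordinatewise[OF this, of j]
  show ?thesis by (rule continuous_on_product_then_coordinatewise)
qed

lemma continuous_on_deadline:
  "continuous_on UNIV (\<lambda>x::('j \<Rightarrow> real) \<times> ('j \<Rightarrow> real \<Rightarrow> real). fst x j)"
  by (rule continuous_on_product_then_coordinatewise) (rule continuous_on_fst[OF continuous_on_id])

lemma closed_profiles: "closed {x :: ('j \<Rightarrow> real) \<times> ('j \<Rightarrow> real \<Rightarrow> real). profile (snd x)}"
proof -
  let ?T = "{(u, v). 0 \<le> u \<and> u \<le> (v::real)}"
  have "{x :: ('j \<Rightarrow> real) \<times> ('j \<Rightarrow> real \<Rightarrow> real). profile (snd x)} =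
      (\<Inter>j\<in>J. {x. snd x j 0 = 0}) \<inter>
      (\<Inter>(j, u, v)\<in>J \<times> ?T. {x. snd x j u \<le> snd x j v \<and> snd x j v - snd x j u \<le> v - u
         \<and> snd x j v - snd x j u \<le> H + \<sigma> * (v - u)}) \<inter>
      (\<Inter>(u, v)\<in>?T. {x. (\<Sum>j\<in>J. snd x j v - snd x j u) \<le> m * (v - u)})"
    by (auto simp: profile_def)
  moreover have "closed {x :: ('j \<Rightarrow> real) \<times> ('j \<Rightarrow> real \<Rightarrow> real). snd x j 0 = 0}" for j
    by (intro closed_Collect_eq continuous_on_work_value continuous_on_const)
  moreover have "closed {x :: ('j \<Rightarrow> real) \<times> ('j \<Rightarrow> real \<Rightarrow> real).
      snd x j u \<le> snd x j v \<and> snd x j v - snd x j u \<le> v - u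
         \<and> snd x j v - snd x j u \<le> H + \<sigma> * (v - u)}" for j u v
    by (intro closed_Collect_conj closed_Collect_le continuous_on_diff continuous_on_work_value
        continuous_on_const)
  moreover have "closed {x :: ('j \<Rightarrow> real) \<times> ('j \<Rightarrow> real \<Rightarrow> real).
      (\<Sum>j\<in>J. snd x j v - snd x j u) \<le> m * (v - u)}" for u v
    by (intro closed_Collect_le continuous_on_sum continuous_on_diff continuous_on_work_value
        continuous_on_const)
  ultimately show ?thesis by (auto intro!: closed_Int closed_INT)
qed

lemma closed_deadlines_met: "closed {x :: ('j \<Rightarrow> real) \<times> ('j \<Rightarrow> real \<Rightarrow> real).
    \<forall>j\<in>J. \<forall>t\<ge>0. p j \<le> snd x j t + \<bar>t - fst x j\<bar>}"
proof -
  have "{x :: ('j \<Rightarrow> real) \<times> ('j \<Rightarrow> real \<Rightarrow> real).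
      \<forall>j\<in>J. \<forall>t\<ge>0. p j \<le> snd x j t + \<bar>t - fst x j\<bar>} =
    (\<Inter>(j, t)\<in>J \<times> {0..}. {x. p j \<le> snd x j t + \<bar>t - fst x j\<bar>})"
    by auto
  moreover have "closed {x :: ('j \<Rightarrow> real) \<times> ('j \<Rightarrow> real \<Rightarrow> real).
      p j \<le> snd x j t + \<bar>t - fst x j\<bar>}" for j t
    by (intro closed_Collect_le continuous_on_add continuous_on_rabs continuous_on_diff
        continuous_on_work_value continuous_on_deadline continuous_on_const)
  ultimately show ?thesis by (auto intro!: closed_INT)
qed

lemma compact_boxed_plans: "compact (boxed_plans B)"
proof -
  define Box where "Box = {d::'j \<Rightarrow> real. \<forall>j. d j \<in> {0..B}} \<times>
    {W::'j \<Rightarrow> real \<Rightarrow> real. \<forall>j. W j \<in> {w. \<forall>t. w t \<in> {0..\<bar>t\<bar>}}}"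
  have "compact Box"
    unfolding Box_def by (intro compact_Times compact_coordinatewise compact_Icc)
  moreover have "boxed_plans B = Box \<inter> ({x. profile (snd x)} \<inter>
      {x. \<forall>j\<in>J. \<forall>t\<ge>0. p j \<le> snd x j t + \<bar>t - fst x j\<bar>})"
  proof -
    have e: "plan d W \<and> (\<forall>j. d j \<in> {0..B}) \<longleftrightarrow> profile W \<and> (\<forall>j. d j \<in> {0..B}) \<and>
        (\<forall>j\<in>J. \<forall>t\<ge>0. p j \<le> W j t + \<bar>t - d j\<bar>)" for d W
    proof -
      have "p j \<le> W j (d j) \<longleftrightarrow> (\<forall>t\<ge>0. p j \<le> W j t + \<bar>t - d j\<bar>)"
        if "profile W" "\<forall>j. d j \<in> {0..B}" "j \<in> J" for j
        using deadline_met_iff[OF that(1,3), of "d j"] that(2) by simp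
      then show ?thesis unfolding plan_def by auto
    qed
    show ?thesis
    proof (rule set_eqI)
      fix x :: "('j \<Rightarrow> real) \<times> ('j \<Rightarrow> real \<Rightarrow> real)"
      obtain d W where x: "x = (d, W)" by (cases x)
      show "x \<in> boxed_plans B \<longleftrightarrow> x \<in> Box \<inter> ({x. profile (snd x)} \<inter>
          {x. \<forall>j\<in>J. \<forall>t\<ge>0. p j \<le> snd x j t + \<bar>t - fst x j\<bar>})"
        using e[of d W] unfolding x boxed_plans_def Box_def
        by (simp only: mem_Collect_eq Int_iff mem_Times_iff case_prod_conv fst_conv snd_conv) blast
    qed
  qed
  ultimately show ?thesis
    by (simp add: compact_Int_closed closed_Int closed_profiles closed_deadlines_met)
qed

lemma plan_boxed:
  assumes "plan d W" "sum d J \<le> B"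
  shows "((\<lambda>j. if j \<in> J then d j else 0), (\<lambda>j t. if j \<in> J \<and> 0 \<le> t then W j t else 0)) \<in> boxed_plans B"
    (is "(?d, ?W) \<in> _")
proof -
  have d0: "0 \<le> d j" if "j \<in> J" for j using assms(1) that by (simp add: plan_def)
  have dB: "d j \<le> B" if "j \<in> J" for j
    using member_le_sum[of j J d] d0 that finite_J assms(2) by fastforce
  have B0: "0 \<le> B" using sum_nonneg[of J d] d0 assms(2) by fastforce
  have "0 \<le> W j t \<and> W j t \<le> t" if "j \<in> J" "0 \<le> t" for j t
    using assms(1) that profile_mono[of W j 0 t] profile_lip[of W j 0 t] profile_0[of W j]
    by (simp add: plan_def)
  moreover have "plan ?d ?W" using assms(1) plan_cong[of d ?d W ?W] by simp
  ultimately show ?thesis unfolding boxed_plans_def using d0 dB B0 by auto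
qed

text \<open>
  The second criterion breaks ties among deadlines of least sum: exchanging the deadlines of two
  jobs keeps the sum and increases \<open>\<Sum>j. p j * d j\<close> exactly if the longer job had the earlier
  deadline.
\<close>

definition optimal :: "('j \<Rightarrow> real) \<Rightarrow> bool" where
  "optimal d \<longleftrightarrow> (\<exists>W. plan d W) \<and> (\<forall>d' W'. plan d' W' \<longrightarrow> sum d J \<le> sum d' J) \<and>
     (\<forall>d' W'. plan d' W' \<and> sum d' J = sum d J \<longrightarrow> (\<Sum>j\<in>J. p j * d' j) \<le> (\<Sum>j\<in>J. p j * d j))"

lemma optimal_exists: "\<exists>d. optimal d"
proof -
  obtain d0 W0 where p0: "plan d0 W0" using plan_exists by blast
  define B where "B = sum d0 J"
  define X where "X = boxed_plans B"
  have "X \<noteq> {}" using plan_boxed[OF p0, of B] unfolding X_def B_def by blast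
  moreover have "continuous_on X (\<lambda>x. \<Sum>j\<in>J. fst x j)"
    by (intro continuous_on_sum continuous_on_subset[OF continuous_on_deadline]) auto
  moreover have cX: "compact X" unfolding X_def by (rule compact_boxed_plans)
  ultimately obtain x where x: "x \<in> X" "\<And>y. y \<in> X \<Longrightarrow> (\<Sum>j\<in>J. fst x j) \<le> (\<Sum>j\<in>J. fst y j)"
    using continuous_attains_inf[of X "\<lambda>x. \<Sum>j\<in>J. fst x j"] by blast
  define \<mu> where "\<mu> = (\<Sum>j\<in>J. fst x j)"
  have min: "\<mu> \<le> sum d J" if "plan d W" for d W
  proof (cases "sum d J \<le> B")
    case True
    then show ?thesis using x(2)[OF plan_boxed[OF that True, folded X_def]] by (simp add: \<mu>_def cong: sum.cong)
  next
    case False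
    have "\<mu> \<le> B" using x(2)[OF plan_boxed[OF p0, of B, folded X_def]] by (simp add: \<mu>_def B_def cong: sum.cong)
    then show ?thesis using False by simp
  qed
  have \<mu>B: "\<mu> \<le> B" using min[OF p0] B_def by simp
  define Y where "Y = X \<inter> {y. (\<Sum>j\<in>J. fst y j) = \<mu>}"
  have "compact Y" unfolding Y_def
    by (intro compact_Int_closed cX closed_Collect_eq continuous_on_sum continuous_on_deadline
        continuous_on_const)
  moreover have "Y \<noteq> {}" using x(1) unfolding Y_def \<mu>_def by auto
  moreover have "continuous_on Y (\<lambda>x. \<Sum>j\<in>J. p j * fst x j)"
    by (intro continuous_on_sum continuous_intros continuous_on_subset[OF continuous_on_deadline]) auto
  ultimately obtain y where y: "y \<in> Y"
      "\<And>z. z \<in> Y \<Longrightarrow> (\<Sum>j\<in>J. p j * fst z j) \<le> (\<Sum>j\<in>J. p j * fst y j)"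
    using continuous_attains_sup[of Y "\<lambda>x. \<Sum>j\<in>J. p j * fst x j"] by blast
  have sy: "sum (fst y) J = \<mu>" using y(1) unfolding Y_def by simp
  have "plan (fst y) (snd y)" using y(1) unfolding Y_def X_def boxed_plans_def by auto
  moreover have "(\<Sum>j\<in>J. p j * d' j) \<le> (\<Sum>j\<in>J. p j * fst y j)"
    if "plan d' W'" "sum d' J = sum (fst y) J" for d' W'
  proof -
    have "sum d' J \<le> B" using that(2) sy \<mu>B by simp
    from plan_boxed[OF that(1) this, folded X_def]
    show ?thesis using y(2) that(2) sy unfolding Y_def by (fastforce cong: sum.cong)
  qed
  ultimately have "optimal (fst y)" unfolding optimal_def using min sy by auto
  then show ?thesis by blast
qed

lemma least_plan:
  fixes Q :: "('j \<Rightarrow> real \<Rightarrow> real) \<Rightarrow> real"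
  assumes d: "plan d W0"
    and Q: "continuous_on UNIV Q"
    and Q_cong: "\<And>W W'. (\<And>j t. j \<in> J \<Longrightarrow> 0 \<le> t \<Longrightarrow> W j t = W' j t) \<Longrightarrow> Q W = Q W'"
  shows "\<exists>W. plan d W \<and> (\<forall>W'. plan d W' \<longrightarrow> Q W \<le> Q W')"
proof -
  define d1 where "d1 j = (if j \<in> J then d j else 0)" for j
  define X where "X = boxed_plans (sum d J) \<inter> {x. \<forall>j. fst x j = d1 j}"
  have "closed {x :: ('j \<Rightarrow> real) \<times> ('j \<Rightarrow> real \<Rightarrow> real). fst x j = d1 j}" for j
    by (intro closed_Collect_eq continuous_on_deadline continuous_on_const)
  then have "compact X" unfolding X_def
    by (intro compact_Int_closed compact_boxed_plans closed_Collect_all)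
  moreover have mem: "(d1, \<lambda>j t. if j \<in> J \<and> 0 \<le> t then W j t else 0) \<in> X" if "plan d W" for W
    using plan_boxed[OF that order_refl] unfolding X_def d1_def by auto
  moreover have "continuous_on X (\<lambda>x. Q (snd x))"
    by (rule continuous_on_compose2[OF Q]) (auto intro: continuous_on_snd continuous_on_id)
  ultimately obtain x where x: "x \<in> X" "\<And>y. y \<in> X \<Longrightarrow> Q (snd x) \<le> Q (snd y)"
    using continuous_attains_inf[of X "\<lambda>x. Q (snd x)"] d by blast
  have "plan (fst x) (snd x)" "\<And>j. fst x j = d1 j" using x(1) unfolding X_def boxed_plans_def by auto
  then have "plan d (snd x)" using plan_cong[of "fst x" d "snd x" "snd x"] by (simp add: d1_def)
  moreover have "Q (snd x) \<le> Q W" if "plan d W" for W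
    using x(2)[OF mem[OF that]] Q_cong[of "\<lambda>j t. if j \<in> J \<and> 0 \<le> t then W j t else 0" W] by simp
  ultimately show ?thesis by blast
qed

text \<open>
  Otherwise the deadline of \<open>j\<close> could be moved forward and the sum of the deadlines would decrease.
\<close>

lemma optimal_plan_tight:
  assumes opt: "optimal d" and W: "plan d W" and j: "j \<in> J"
  shows "0 \<le> t \<Longrightarrow> p j \<le> W j t \<Longrightarrow> d j \<le> t" and "W j (d j) = p j"
proof -
  show early: "d j \<le> t" if t: "0 \<le> t" "p j \<le> W j t" for t
  proof -
    have "plan (d(j := t)) W" using W t unfolding plan_def by simp
    then have "sum d J \<le> sum (d(j := t)) J" using opt unfolding optimal_def by blast
    also have "\<dots> = t + sum d (J - {j})"
      using j finite_J by (subst sum.remove[of _ j]) (auto intro: sum.cong)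
    finally show ?thesis using j finite_J by (subst (asm) sum.remove[of _ j]) auto
  qed
  have "p j \<le> W j (d j)" "profile W" "0 \<le> d j" using W j by (auto simp: plan_def)
  \<comment> \<open>Surplus work at the deadline: since \<open>W j\<close> is 1-Lipschitz, the job is already done at \<open>t\<close>.\<close>
  define t where "t = d j - (W j (d j) - p j)"
  have "W j (d j) \<le> d j" using profile_lip[OF \<open>profile W\<close> j, of 0 "d j"] profile_0[OF \<open>profile W\<close> j] \<open>0 \<le> d j\<close> by simp
  then have t: "0 \<le> t" "t \<le> d j" using p_pos[OF j] \<open>p j \<le> W j (d j)\<close> unfolding t_def by auto
  then have "W j (d j) - W j t \<le> d j - t" by (intro profile_lip[OF \<open>profile W\<close> j])
  then have "p j \<le> W j t" unfolding t_def by simp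
  then have "d j \<le> t" using t by (intro early)
  then show "W j (d j) = p j" using t \<open>p j \<le> W j (d j)\<close> unfolding t_def by simp
qed

lemma profile_continuous_on:
  assumes "profile W" "j \<in> J" shows "continuous_on {0..} (W j)"
proof (rule lipschitz_on_continuous_on)
  show "1-lipschitz_on {0..} (W j)"
  proof (rule lipschitz_onI)
    fix x y :: real assume "x \<in> {0..}" "y \<in> {0..}"
    then show "dist (W j x) (W j y) \<le> 1 * dist x y"
      using profile_lip[OF assms, of x y] profile_lip[OF assms, of y x]
        profile_mono[OF assms, of x y] profile_mono[OF assms, of y x]
      by (cases "x \<le> y") (auto simp: dist_real_def)
  qed simp
qed

text \<open>
  After the time \<open>s\<close>, the first one at which \<open>a\<close> leads by \<open>p a - p b\<close>, the two jobs exchange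
  their loads, and \<open>a\<close> rests after \<open>d b\<close>. The choice of the lead makes \<open>b\<close> finish
  at \<open>d a\<close> and \<open>a\<close> at \<open>d b\<close>. The heat bound for \<open>a\<close> is checked at \<open>s\<close> and at \<open>d b\<close> only, by the
  peak assumption: at \<open>d b\<close> job \<open>a\<close> has done the same work as before at \<open>d a\<close>, only later. For \<open>b\<close>
  it follows from the minimality of \<open>s\<close>.
\<close>

lemma swap_deadlines:
  assumes W: "plan d W" and ab: "a \<in> J" "b \<in> J" and dab: "d a < d b" and pab: "p b < p a"
    and tight: "W a (d a) = p a" "W b (d b) = p b"
    and peak: "\<And>s v. 0 \<le> s \<Longrightarrow> s \<le> v \<Longrightarrow> v \<le> d b \<Longrightarrow>
        W b v - \<sigma> * v \<le> max (W b s - \<sigma> * s) (W b (d b) - \<sigma> * d b)"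
  shows "\<exists>W'. plan (d(a := d b, b := d a)) W'"
proof -
  have prof: "profile W" and da0: "0 \<le> d a" using W ab by (auto simp: plan_def)
  note mono = profile_mono[OF prof] and lip = profile_lip[OF prof] and win = profile_window[OF prof]
  define \<Delta> where "\<Delta> t = W a t - W b t" for t
  define c where "c = p a - p b"
  have cont: "continuous_on {0..r} \<Delta>" for r
    unfolding \<Delta>_def
    by (intro continuous_on_diff continuous_on_subset[OF profile_continuous_on[OF prof]] ab) auto
  have "W b (d a) \<le> p b" using mono[OF ab(2), of "d a" "d b"] dab da0 tight by simp
  then have end_ge: "c \<le> \<Delta> (d a)" unfolding \<Delta>_def c_def tight by simp
  \<comment> \<open>The first time at which the lead of \<open>a\<close> is at least \<open>c\<close>; by continuity it is exactly \<open>c\<close> then.\<close>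
  define E where "E = {t \<in> {0..d a}. c \<le> \<Delta> t}"
  have "closed E" unfolding E_def
    by (intro continuous_on_closed_Collect_le cont continuous_on_const) simp
  then have cE: "compact E" unfolding E_def
    by (metis (no_types, lifting) bounded_closed_interval bounded_subset compact_eq_bounded_closed
        mem_Collect_eq subsetI)
  have "E \<noteq> {}" using end_ge da0 unfolding E_def by auto
  from compact_attains_inf[OF cE this]
  obtain s where s: "s \<in> E" "\<And>t. t \<in> E \<Longrightarrow> s \<le> t" by blast
  have s0: "0 \<le> s" "s \<le> d a" "c \<le> \<Delta> s" using s(1) unfolding E_def by auto
  have "\<Delta> 0 \<le> c" using pab profile_0[OF prof] ab unfolding \<Delta>_def c_def by simp
  then obtain u where u: "0 \<le> u" "u \<le> s" "\<Delta> u = c"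
    using IVT'[of \<Delta> 0 c s] s0 cont by blast
  then have "u \<in> E" using s0 unfolding E_def by auto
  then have "u = s" using s(2) u by force
  then have \<Delta>s: "W a s = W b s + c" using u unfolding \<Delta>_def by simp
  \<comment> \<open>Minimality of \<open>s\<close>: no interval ending at \<open>s\<close> has \<open>b\<close> ahead of \<open>a\<close>.\<close>
  have first: "W b s - W b u \<le> W a s - W a u" if "0 \<le> u" "u \<le> s" for u
  proof (cases "u = s")
    case False
    then have "u \<notin> E" using s(2)[of u] that by auto
    then have "\<Delta> u < c" using that s0 unfolding E_def by auto
    then show ?thesis using \<Delta>s unfolding \<Delta>_def by simp
  qed simp
  define W' where "W' j t =
    (if j = a then if t \<le> s then W a t else W b (min t (d b)) + c
     else if j = b then if t \<le> s then W b t else W a t - c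
     else W j t)" for j t
  have "a \<noteq> b" using dab by auto
  then have W'a: "W' a t = (if t \<le> s then W a t else W b (min t (d b)) + c)"
    and W'b: "W' b t = (if t \<le> s then W b t else W a t - c)" for t
    by (auto simp: W'_def)
  have sdb: "s < d b" using s0 dab by simp
  have a_ok: "W' a u \<le> W' a v \<and> W' a v - W' a u \<le> v - u \<and> W' a v - W' a u \<le> H + \<sigma> * (v - u)
      \<and> W' b u \<le> W' b v \<and> W' b v - W' b u \<le> v - u \<and> W' b v - W' b u \<le> H + \<sigma> * (v - u)
      \<and> (W' a v - W' a u) + (W' b v - W' b u) \<le> (W a v - W a u) + (W b v - W b u)"
    if uv: "0 \<le> u" "u \<le> v" for u v
  proof -
    consider "v \<le> s" | "u \<le> s" "s < v" | "s < u" by linarith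
    then show ?thesis
    proof cases
      case 1
      then show ?thesis
        using uv mono[OF ab(1) uv] mono[OF ab(2) uv] lip[OF ab(1) uv] lip[OF ab(2) uv]
          win[OF ab(1) uv] win[OF ab(2) uv] unfolding W'a W'b by simp
    next
      case 2
      define w where "w = min v (d b)"
      have w: "s \<le> w" "w \<le> v" "w \<le> d b" using 2 sdb unfolding w_def by auto
      have ia: "W' a v - W' a u = (W b w - W b s) + (W a s - W a u)"
        using 2 \<Delta>s unfolding W'a w_def by simp
      have ib: "W' b v - W' b u = (W a v - W a s) + (W b s - W b u)"
        using 2 \<Delta>s unfolding W'b by simp
      have sw: "\<sigma> * w \<le> \<sigma> * v" "\<sigma> * d a \<le> \<sigma> * d b" using w \<sigma>_pos dab by auto
      have "W b w - \<sigma> * w \<le> W b s - \<sigma> * s \<or> W b w - \<sigma> * w \<le> p b - \<sigma> * d b"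
        using peak[of s w] s0 w tight by (simp add: le_max_iff_disj)
      then have "W' a v - W' a u \<le> H + \<sigma> * (v - u)"
      proof
        assume "W b w - \<sigma> * w \<le> W b s - \<sigma> * s"
        then show ?thesis using win[OF ab(1), of u s] 2 uv sw unfolding ia by (simp add: algebra_simps)
      next
        assume "W b w - \<sigma> * w \<le> p b - \<sigma> * d b"
        then show ?thesis using win[OF ab(1), of u "d a"] 2 uv sw s0 \<Delta>s tight unfolding ia c_def
          by (simp add: algebra_simps)
      qed
      moreover have "W' b v - W' b u \<le> H + \<sigma> * (v - u)"
        using win[OF ab(1) uv] first[OF uv(1) 2(1)] unfolding ib by simp
      moreover have "W b w \<le> W b v" "W b s \<le> W b w" "W a s \<le> W a v" "W a u \<le> W a s" "W b u \<le> W b s"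
        using 2 uv w s0 ab by (auto intro!: mono)
      moreover have "W b w - W b s \<le> w - s" "W a v - W a s \<le> v - s" "W a s - W a u \<le> s - u"
          "W b s - W b u \<le> s - u"
        using 2 uv w s0 ab by (auto intro!: lip)
      ultimately show ?thesis using w ia ib by (intro conjI) linarith+
    next
      case 3
      define x y where "x = min u (d b)" and "y = min v (d b)"
      have xy: "0 \<le> x" "x \<le> y" "y - x \<le> v - u" "0 \<le> y" using 3 uv sdb s0 unfolding x_def y_def by auto
      have "W b y - W b x \<le> W b v - W b u"
        using mono[OF ab(2), of "d b" v] mono[OF ab(2) uv] uv sdb s0 unfolding x_def y_def by (simp add: min_def)
      moreover have "\<sigma> * (y - x) \<le> \<sigma> * (v - u)" using xy \<sigma>_pos by simp
      ultimately show ?thesis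
        using 3 uv mono[OF ab(1) uv] lip[OF ab(1) uv] win[OF ab(1) uv]
          mono[OF ab(2) xy(1,2)] lip[OF ab(2) xy(1,2)] win[OF ab(2) xy(1,2)] xy
        unfolding W'a W'b x_def[symmetric] y_def[symmetric] by simp
    qed
  qed
  have "profile W'"
    unfolding profile_def
  proof (intro conjI ballI allI impI)
    fix j assume "j \<in> J"
    then show "W' j 0 = 0" using s0 profile_0[OF prof] unfolding W'_def by auto
  next
    fix j u v assume j: "j \<in> J" and uv: "0 \<le> u \<and> u \<le> (v::real)"
    have "W' j u \<le> W' j v \<and> W' j v - W' j u \<le> v - u \<and> W' j v - W' j u \<le> H + \<sigma> * (v - u)"
    proof (cases "j = a \<or> j = b")
      case True
      then show ?thesis using a_ok[of u v] uv by blast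
    next
      case False
      then have "W' j = W j" by (auto simp: W'_def)
      then show ?thesis using mono[OF j] lip[OF j] win[OF j] uv by simp
    qed
    then show "W' j u \<le> W' j v" "W' j v - W' j u \<le> v - u" "W' j v - W' j u \<le> H + \<sigma> * (v - u)"
      by blast+
  next
    fix u v :: real assume uv: "0 \<le> u \<and> u \<le> v"
    have split: "sum f J = f a + (f b + sum f (J - {a} - {b}))" for f :: "'j \<Rightarrow> real"
      using ab \<open>a \<noteq> b\<close> finite_J sum.remove[of J a f] sum.remove[of "J - {a}" b f] by simp
    have "(\<Sum>j\<in>J - {a} - {b}. W' j v - W' j u) = (\<Sum>j\<in>J - {a} - {b}. W j v - W j u)"
      by (rule sum.cong) (auto simp: W'_def)
    then have "(\<Sum>j\<in>J. W' j v - W' j u) \<le> (\<Sum>j\<in>J. W j v - W j u)"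
      unfolding split using a_ok[of u v] uv by simp
    then show "(\<Sum>j\<in>J. W' j v - W' j u) \<le> m * (v - u)"
      using profile_total[OF prof] uv by fastforce
  qed
  moreover have "p a \<le> W' a (d b)" using sdb tight unfolding W'a c_def by simp
  moreover have "p b \<le> W' b (d a)"
  proof (cases "d a \<le> s")
    case True
    then have "s = d a" using s0 by simp
    then show ?thesis using \<Delta>s tight unfolding W'b c_def by simp
  next
    case False
    then show ?thesis using tight unfolding W'b c_def by simp
  qed
  moreover have "p j \<le> W' j (d j)" if "j \<in> J" "j \<noteq> a" "j \<noteq> b" for j
    using W that unfolding plan_def W'_def by simp
  ultimately have "plan (d(a := d b, b := d a)) W'"
    using W \<open>a \<noteq> b\<close> ab unfolding plan_def by auto
  then show ?thesis by blast
qed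

lemma optimal_order:
  assumes opt: "optimal d" and W: "plan d W" and ab: "a \<in> J" "b \<in> J" and pab: "p b < p a"
    and peak: "\<And>s v. 0 \<le> s \<Longrightarrow> s \<le> v \<Longrightarrow> v \<le> d b \<Longrightarrow>
        W b v - \<sigma> * v \<le> max (W b s - \<sigma> * s) (W b (d b) - \<sigma> * d b)"
  shows "d b \<le> d a"
proof (rule ccontr)
  assume "\<not> d b \<le> d a"
  then have dab: "d a < d b" by simp
  then have ne: "a \<noteq> b" by auto
  define d' where "d' = d(a := d b, b := d a)"
  obtain W' where W': "plan d' W'"
    using swap_deadlines[OF W ab dab pab optimal_plan_tight(2)[OF opt W ab(1)]
        optimal_plan_tight(2)[OF opt W ab(2)] peak] unfolding d'_def by blast
  have split: "sum f J = f a + (f b + sum f (J - {a} - {b}))" for f :: "'j \<Rightarrow> real"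
    using ab ne finite_J sum.remove[of J a f] sum.remove[of "J - {a}" b f] by simp
  have "sum d' (J - {a} - {b}) = sum d (J - {a} - {b})"
    "(\<Sum>j\<in>J - {a} - {b}. p j * d' j) = (\<Sum>j\<in>J - {a} - {b}. p j * d j)"
    by (auto simp: d'_def intro: sum.cong)
  then have "sum d' J = sum d J"
    "(\<Sum>j\<in>J. p j * d' j) - (\<Sum>j\<in>J. p j * d j) = (p a - p b) * (d b - d a)"
    unfolding split[of d] split[of d'] split[of "\<lambda>j. p j * d j"] split[of "\<lambda>j. p j * d' j"]
    using ne by (auto simp: d'_def algebra_simps)
  moreover have "0 < (p a - p b) * (d b - d a)" using pab dab by simp
  ultimately show False using opt W' unfolding optimal_def by force
qed

end

section \<open>Monotone loads by exchanging work\<close>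

locale cooled_jobs_on_grid = cooled_jobs J m \<sigma> H p + time_grid \<tau>
  for J :: "'j set" and m \<sigma> H :: real and p :: "'j \<Rightarrow> real" and \<tau> :: "nat \<Rightarrow> real"
begin

definition job_values :: "(nat \<Rightarrow> real) \<Rightarrow> bool" where
  "job_values V \<longleftrightarrow> V 0 = 0 \<and> (\<forall>i. V i \<le> V (Suc i) \<and> V (Suc i) - V i \<le> \<tau> (Suc i) - \<tau> i) \<and>
     (\<forall>i l. i \<le> l \<longrightarrow> V l - V i \<le> H + \<sigma> * (\<tau> l - \<tau> i))"

definition total_values :: "('j \<Rightarrow> nat \<Rightarrow> real) \<Rightarrow> bool" where
  "total_values V \<longleftrightarrow> (\<forall>i. (\<Sum>j\<in>J. V j (Suc i) - V j i) \<le> m * (\<tau> (Suc i) - \<tau> i))"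

lemma profile_interp:
  assumes V: "\<And>j. j \<in> J \<Longrightarrow> job_values (V j)" and tot: "total_values V"
  shows "profile (\<lambda>j. interp (V j))"
  unfolding profile_def
proof (intro conjI ballI allI impI)
  fix j assume j: "j \<in> J"
  note vj = V[OF j, unfolded job_values_def]
  show "interp (V j) 0 = 0" using vj interp_tau[of "V j" 0] by (simp add: start)
  fix u v :: real assume uv: "0 \<le> u \<and> u \<le> v"
  have "interp (\<lambda>i. - V j i) v - interp (\<lambda>i. - V j i) u \<le> 0 * (v - u)"
    using vj uv by (intro interp_increment_le_of_steps) auto
  then show "interp (V j) u \<le> interp (V j) v" by (simp add: interp_uminus)
  have "interp (V j) v - interp (V j) u \<le> 1 * (v - u)"
    using vj uv by (intro interp_increment_le_of_steps) auto
  then show "interp (V j) v - interp (V j) u \<le> v - u" by simp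
  show "interp (V j) v - interp (V j) u \<le> H + \<sigma> * (v - u)"
    using vj uv H_pos by (intro interp_increment_le) auto
next
  fix u v :: real assume uv: "0 \<le> u \<and> u \<le> v"
  have "interp (\<lambda>i. \<Sum>j\<in>J. V j i) v - interp (\<lambda>i. \<Sum>j\<in>J. V j i) u \<le> m * (v - u)"
    using tot uv unfolding total_values_def
    by (intro interp_increment_le_of_steps) (auto simp: sum_subtractf)
  then show "(\<Sum>j\<in>J. interp (V j) v - interp (V j) u) \<le> m * (v - u)"
    by (simp add: interp_sum sum_subtractf)
qed

lemma job_values_sample:
  assumes "profile W" "j \<in> J" shows "job_values (\<lambda>i. W j (\<tau> i))"
proof -
  have ii: "0 \<le> \<tau> i" "\<tau> i \<le> \<tau> (Suc i)" for i using tau_nonneg[of i] step_pos[of i] by auto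
  show ?thesis
    unfolding job_values_def using profile_0[OF assms] profile_mono[OF assms ii]
      profile_lip[OF assms ii] profile_window[OF assms tau_nonneg]
    by (simp add: start tau_le)
qed

lemma total_values_sample:
  assumes "profile W" shows "total_values (\<lambda>j i. W j (\<tau> i))"
  unfolding total_values_def
  using profile_total[OF assms tau_nonneg] step_pos by (simp add: less_imp_le)

text \<open>
  The integral of the squared load of the interpolation up to \<open>\<tau> k\<close>; its strict convexity
  makes it detect loads that can be evened out.
\<close>

definition energy :: "nat \<Rightarrow> (nat \<Rightarrow> real) \<Rightarrow> real" where
  "energy k V = (\<Sum>i<k. (V (Suc i) - V i)\<^sup>2 / (\<tau> (Suc i) - \<tau> i))"

lemma energy_update:
  assumes i: "Suc i < k"
  shows "energy k (V(Suc i := V (Suc i) + e)) = energy k V + 2 * e * (slope V i - slope V (Suc i))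
     + e\<^sup>2 * (1 / (\<tau> (Suc i) - \<tau> i) + 1 / (\<tau> (Suc (Suc i)) - \<tau> (Suc i)))"
proof -
  define V' where "V' = V(Suc i := V (Suc i) + e)"
  define f where "f V l = (V (Suc l) - V l)\<^sup>2 / (\<tau> (Suc l) - \<tau> l)" for V l
  define R where "R = {..<k} - {i} - {Suc i}"
  have split: "energy k V = f V i + (f V (Suc i) + sum (f V) R)" for V
    using i sum.remove[of "{..<k}" i "f V"] sum.remove[of "{..<k} - {i}" "Suc i" "f V"]
    unfolding R_def energy_def f_def by simp
  have R: "sum (f V') R = sum (f V) R"
    by (rule sum.cong) (auto simp: R_def f_def V'_def)
  define l1 l2 where "l1 = \<tau> (Suc i) - \<tau> i" and "l2 = \<tau> (Suc (Suc i)) - \<tau> (Suc i)"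
  have l: "0 < l1" "0 < l2" using step_pos unfolding l1_def l2_def by auto
  have "f V' i = f V i + 2 * e * slope V i + e\<^sup>2 * (1 / l1)"
    using l(1) unfolding f_def V'_def slope_def l1_def[symmetric]
    by (simp add: field_simps power2_eq_square)
  moreover have "f V' (Suc i) = f V (Suc i) - 2 * e * slope V (Suc i) + e\<^sup>2 * (1 / l2)"
    using l(2) unfolding f_def V'_def slope_def l2_def[symmetric]
    by (simp add: field_simps power2_eq_square)
  ultimately show ?thesis unfolding split R V'_def[symmetric] l1_def[symmetric] l2_def[symmetric]
    by (simp add: algebra_simps)
qed

lemma eventually_energy_less:
  assumes i: "Suc i < k" and \<eta>: "\<eta> * (slope V i - slope V (Suc i)) < 0"
  shows "\<forall>\<^sub>F e in at_right 0. energy k (V(Suc i := V (Suc i) + \<eta> * e)) < energy k V"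
proof -
  \<comment> \<open>The energy changes by \<open>- 2 D e + B e\<^sup>2\<close>.\<close>
  define B where "B = \<eta>\<^sup>2 * (1 / (\<tau> (Suc i) - \<tau> i) + 1 / (\<tau> (Suc (Suc i)) - \<tau> (Suc i)))"
  define D where "D = - (\<eta> * (slope V i - slope V (Suc i)))"
  have B: "0 \<le> B" unfolding B_def using step_pos[of i] step_pos[of "Suc i"]
    by (intro mult_nonneg_nonneg add_nonneg_nonneg) auto
  have D: "0 < D" using \<eta> unfolding D_def by simp
  have "energy k (V(Suc i := V (Suc i) + \<eta> * e)) < energy k V" if e: "0 < e" "e < D / (B + 1)" for e
  proof -
    have "e * (B + 1) < D" using e B by (simp add: field_simps)
    then have "e * B < 2 * D" using e D by (simp add: algebra_simps)
    then have "e * (e * B) < e * (2 * D)" using e by simp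
    moreover have "energy k (V(Suc i := V (Suc i) + \<eta> * e)) = energy k V - e * (2 * D) + e * (e * B)"
      unfolding energy_update[OF i] B_def D_def by (simp add: algebra_simps power2_eq_square)
    ultimately show ?thesis by linarith
  qed
  moreover have "0 < D / (B + 1)" using D B by simp
  ultimately show ?thesis unfolding eventually_at_right_field by blast
qed

text \<open>
  The critical heat bounds are those over grid intervals that end at \<open>Suc i\<close>. Comparison with
  the intervals ending one step later and one step earlier shows that each of them has slack at
  least \<open>x2 - \<sigma> * l2\<close> and at least \<open>\<sigma> * l1 - x1\<close>. Since the slope increases, one of these
  is positive, and it does not depend on the interval.
\<close>

lemma eventually_job_values_raise:
  assumes V: "job_values V" and sl: "slope V i < slope V (Suc i)"
  shows "\<forall>\<^sub>F e in at_right 0. job_values (V(Suc i := V (Suc i) + e))"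
proof -
  define l1 l2 x1 x2 where "l1 = \<tau> (Suc i) - \<tau> i" and "l2 = \<tau> (Suc (Suc i)) - \<tau> (Suc i)"
    and "x1 = V (Suc i) - V i" and "x2 = V (Suc (Suc i)) - V (Suc i)"
  note defs = l1_def l2_def x1_def x2_def
  have l: "0 < l1" "0 < l2" using step_pos unfolding defs by auto
  have x: "0 \<le> x1" "x2 \<le> l2" using V unfolding job_values_def defs by auto
  have r: "x1 / l1 < x2 / l2" using sl unfolding slope_def defs .
  have "x2 / l2 \<le> 1" using x l by simp
  then have "x1 / l1 < 1" using r by linarith
  then have c1: "0 < l1 - x1" using l by simp
  have "0 \<le> x1 / l1" using x l by simp
  then have "0 < x2 / l2" using r by linarith
  then have c2: "0 < x2" using l by (simp add: zero_less_divide_iff)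
  have c3: "0 < max (x2 - \<sigma> * l2) (\<sigma> * l1 - x1)"
  proof (cases "\<sigma> < x2 / l2")
    case True
    then show ?thesis using l by (simp add: field_simps)
  next
    case False
    then have "x1 / l1 < \<sigma>" using r by simp
    then show ?thesis using l by (simp add: field_simps)
  qed
  have "job_values (V(Suc i := V (Suc i) + e))" (is "job_values ?V")
    if e: "0 < e" "e < min (l1 - x1) (min x2 (max (x2 - \<sigma> * l2) (\<sigma> * l1 - x1)))" for e
    unfolding job_values_def
  proof (intro conjI allI impI)
    show "?V 0 = 0" using V by (simp add: job_values_def)
    fix a
    show "?V a \<le> ?V (Suc a)" "?V (Suc a) - ?V a \<le> \<tau> (Suc a) - \<tau> a"
    proof -
      have "V a \<le> V (Suc a)" "V (Suc a) - V a \<le> \<tau> (Suc a) - \<tau> a"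
        using V unfolding job_values_def by blast+
      then show "?V a \<le> ?V (Suc a)" "?V (Suc a) - ?V a \<le> \<tau> (Suc a) - \<tau> a"
        using e unfolding defs by auto
    qed
  next
    fix a c :: nat assume ac: "a \<le> c"
    have win: "V c - V a \<le> H + \<sigma> * (\<tau> c - \<tau> a)" if "a \<le> c" for a c
      using V that unfolding job_values_def by blast
    consider "a = c" | "c = Suc i" "a \<le> i" | "a = Suc i" "a < c" | "a \<noteq> Suc i" "c \<noteq> Suc i"
      using ac by linarith
    then show "?V c - ?V a \<le> H + \<sigma> * (\<tau> c - \<tau> a)"
    proof cases
      case 2
      have "e \<le> x2 - \<sigma> * l2 \<or> e \<le> \<sigma> * l1 - x1" using e by (auto simp: less_max_iff_disj)
      then show ?thesis
        using 2 win[of a "Suc (Suc i)"] win[of a i] unfolding defs by (auto simp: algebra_simps)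
    qed (use win[OF ac] e H_pos in auto)
  qed
  moreover have "0 < min (l1 - x1) (min x2 (max (x2 - \<sigma> * l2) (\<sigma> * l1 - x1)))"
    using c1 c2 c3 by simp
  ultimately show ?thesis unfolding eventually_at_right_field by blast
qed

text \<open>
  As for raising, with the grid intervals that start at \<open>Suc i\<close>: they are compared with the ones
  starting one step earlier and one step later.
\<close>

lemma eventually_job_values_lower:
  assumes V: "job_values V" and sl: "slope V (Suc i) < slope V i"
  shows "\<forall>\<^sub>F e in at_right 0. job_values (V(Suc i := V (Suc i) - e))"
proof -
  define l1 l2 x1 x2 where "l1 = \<tau> (Suc i) - \<tau> i" and "l2 = \<tau> (Suc (Suc i)) - \<tau> (Suc i)"
    and "x1 = V (Suc i) - V i" and "x2 = V (Suc (Suc i)) - V (Suc i)"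
  note defs = l1_def l2_def x1_def x2_def
  have l: "0 < l1" "0 < l2" using step_pos unfolding defs by auto
  have x: "0 \<le> x2" "x1 \<le> l1" using V unfolding job_values_def defs by auto
  have r: "x2 / l2 < x1 / l1" using sl unfolding slope_def defs .
  have "x1 / l1 \<le> 1" using x l by simp
  then have "x2 / l2 < 1" using r by linarith
  then have c1: "0 < l2 - x2" using l by simp
  have "0 \<le> x2 / l2" using x l by simp
  then have "0 < x1 / l1" using r by linarith
  then have c2: "0 < x1" using l by (simp add: zero_less_divide_iff)
  have c3: "0 < max (x1 - \<sigma> * l1) (\<sigma> * l2 - x2)"
  proof (cases "\<sigma> < x1 / l1")
    case True
    then show ?thesis using l by (simp add: field_simps)
  next
    case False
    then have "x2 / l2 < \<sigma>" using r by simp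
    then show ?thesis using l by (simp add: field_simps)
  qed
  have "job_values (V(Suc i := V (Suc i) - e))" (is "job_values ?V")
    if e: "0 < e" "e < min (l2 - x2) (min x1 (max (x1 - \<sigma> * l1) (\<sigma> * l2 - x2)))" for e
    unfolding job_values_def
  proof (intro conjI allI impI)
    show "?V 0 = 0" using V by (simp add: job_values_def)
    fix a
    show "?V a \<le> ?V (Suc a)" "?V (Suc a) - ?V a \<le> \<tau> (Suc a) - \<tau> a"
    proof -
      have "V a \<le> V (Suc a)" "V (Suc a) - V a \<le> \<tau> (Suc a) - \<tau> a"
        using V unfolding job_values_def by blast+
      then show "?V a \<le> ?V (Suc a)" "?V (Suc a) - ?V a \<le> \<tau> (Suc a) - \<tau> a"
        using e unfolding defs by auto
    qed
  next
    fix a c :: nat assume ac: "a \<le> c"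
    have win: "V c - V a \<le> H + \<sigma> * (\<tau> c - \<tau> a)" if "a \<le> c" for a c
      using V that unfolding job_values_def by blast
    consider "a = c" | "c = Suc i" "a \<le> i" | "a = Suc i" "Suc (Suc i) \<le> c" | "a \<noteq> Suc i" "c \<noteq> Suc i"
      using ac by linarith
    then show "?V c - ?V a \<le> H + \<sigma> * (\<tau> c - \<tau> a)"
    proof cases
      case 3
      have "e \<le> x1 - \<sigma> * l1 \<or> e \<le> \<sigma> * l2 - x2" using e by (auto simp: less_max_iff_disj)
      then show ?thesis
        using 3 win[of i c] win[of "Suc (Suc i)" c] unfolding defs by (auto simp: algebra_simps)
    qed (use win[OF ac] e H_pos in auto)
  qed
  moreover have "0 < min (l2 - x2) (min x1 (max (x1 - \<sigma> * l1) (\<sigma> * l2 - x2)))"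
    using c1 c2 c3 by simp
  ultimately show ?thesis unfolding eventually_at_right_field by blast
qed

text \<open>
  If the machines have room in the cell after \<open>Suc i\<close>, only \<open>b\<close> has to postpone work. If they are
  fully used there, the slopes sum to \<open>m\<close> in that cell and to at most \<open>m\<close> in the previous one, so
  the decreasing slope of \<open>b\<close> is compensated by an increasing slope of some other job, which can
  take over the work that \<open>b\<close> leaves undone before \<open>Suc i\<close>.
\<close>

lemma exchange_direction:
  assumes tot: "total_values V" and b: "b \<in> J" and desc: "slope (V b) (Suc i) < slope (V b) i"
  obtains \<eta> :: "'j \<Rightarrow> real" where
    "\<And>j. j \<in> J \<Longrightarrow> \<eta> j = 0 \<or> \<eta> j = 1 \<and> slope (V j) i < slope (V j) (Suc i) \<or> \<eta> j = - 1 \<and> j = b"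
    "\<eta> b = - 1"
    "sum \<eta> J = 0 \<or> sum \<eta> J = - 1 \<and>
       (\<Sum>j\<in>J. V j (Suc (Suc i)) - V j (Suc i)) < m * (\<tau> (Suc (Suc i)) - \<tau> (Suc i))"
proof (cases "(\<Sum>j\<in>J. V j (Suc (Suc i)) - V j (Suc i)) < m * (\<tau> (Suc (Suc i)) - \<tau> (Suc i))")
  case True
  show thesis
  proof (rule that[of "\<lambda>j. if j = b then - 1 else 0"])
    show "sum (\<lambda>j. if j = b then - 1 else 0) J = (0::real) \<or> sum (\<lambda>j. if j = b then - 1 else 0) J = (- 1::real) \<and>
       (\<Sum>j\<in>J. V j (Suc (Suc i)) - V j (Suc i)) < m * (\<tau> (Suc (Suc i)) - \<tau> (Suc i))"
      using True b finite_J by simp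
  qed auto
next
  case False
  have sum_slope: "(\<Sum>j\<in>J. slope (V j) l) = (\<Sum>j\<in>J. V j (Suc l) - V j l) / (\<tau> (Suc l) - \<tau> l)" for l
    unfolding slope_def by (rule sum_divide_distrib[symmetric])
  have "(\<Sum>j\<in>J. slope (V j) i) \<le> m"
    using tot step_pos[of i] unfolding sum_slope total_values_def by (simp add: field_simps)
  moreover have "m \<le> (\<Sum>j\<in>J. slope (V j) (Suc i))"
    using False step_pos[of "Suc i"] unfolding sum_slope by (simp add: field_simps)
  moreover have "(\<Sum>j\<in>J. slope (V j) (Suc i)) < (\<Sum>j\<in>J. slope (V j) i)"
    if "\<And>j. j \<in> J \<Longrightarrow> slope (V j) (Suc i) \<le> slope (V j) i"
    using that b desc finite_J by (intro sum_strict_mono_ex1) auto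
  ultimately obtain c where c: "c \<in> J" "slope (V c) i < slope (V c) (Suc i)"
    by (meson not_le order.strict_trans2 order_less_irrefl)
  then have cb: "c \<noteq> b" using desc by auto
  define \<eta> :: "'j \<Rightarrow> real" where "\<eta> j = (if j = c then 1 else 0) - (if j = b then 1 else 0)" for j
  have "sum \<eta> J = 0" unfolding \<eta>_def sum_subtractf using b c finite_J by simp
  then show thesis using c cb by (intro that[of \<eta>]) (auto simp: \<eta>_def)
qed

text \<open>
  A descent of the load of \<open>b\<close> at grid point \<open>Suc i\<close> would allow a move along the direction of
  \<open>exchange_direction\<close>: only values at this grid point change, all conditions survive
  for small steps, and the energy decreases. The only deadline endangered by lowering \<open>V b\<close> at
  \<open>Suc i\<close> would be that of \<open>b\<close>, which lies later since \<open>Suc i < n\<close>.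
\<close>

lemma least_energy_slopes:
  assumes W: "plan d W"
    and least: "\<And>W'. plan d W' \<Longrightarrow>
      (\<Sum>j\<in>J. energy k (\<lambda>i. W j (\<tau> i))) \<le> (\<Sum>j\<in>J. energy k (\<lambda>i. W' j (\<tau> i)))"
    and grid: "\<And>j. j \<in> J \<Longrightarrow> d j \<in> range \<tau>"
    and b: "b \<in> J" "d b = \<tau> n" "n \<le> k" and i: "Suc i < n"
  shows "slope (\<lambda>i. W b (\<tau> i)) i \<le> slope (\<lambda>i. W b (\<tau> i)) (Suc i)"
proof (rule ccontr)
  define V where "V j i = W j (\<tau> i)" for j i
  assume "\<not> slope (\<lambda>i. W b (\<tau> i)) i \<le> slope (\<lambda>i. W b (\<tau> i)) (Suc i)"
  then have desc: "slope (V b) (Suc i) < slope (V b) i" unfolding V_def by simp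
  have prof: "profile W" using W by (simp add: plan_def)
  have jv: "job_values (V j)" if "j \<in> J" for j
    using job_values_sample[OF prof that] unfolding V_def .
  have tot: "total_values V" using total_values_sample[OF prof] unfolding V_def .
  obtain \<eta> :: "'j \<Rightarrow> real" where \<eta>:
    "\<And>j. j \<in> J \<Longrightarrow> \<eta> j = 0 \<or> \<eta> j = 1 \<and> slope (V j) i < slope (V j) (Suc i) \<or> \<eta> j = - 1 \<and> j = b"
    and \<eta>b: "\<eta> b = - 1"
    and \<eta>sum: "sum \<eta> J = 0 \<or> sum \<eta> J = - 1 \<and>
       (\<Sum>j\<in>J. V j (Suc (Suc i)) - V j (Suc i)) < m * (\<tau> (Suc (Suc i)) - \<tau> (Suc i))"
    by (rule exchange_direction[OF tot b(1) desc]) (rule that, assumption+)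
  define V' where "V' e j = (V j)(Suc i := V j (Suc i) + \<eta> j * e)" for e j
  have "\<forall>\<^sub>F e in at_right 0. job_values (V' e j) \<and> energy k (V' e j) \<le> energy k (V j)
      \<and> (j = b \<longrightarrow> energy k (V' e j) < energy k (V j))" if j: "j \<in> J" for j
    using \<eta>[OF j]
  proof (elim disjE conjE)
    assume "\<eta> j = 0"
    then have "V' e j = V j" for e unfolding V'_def by simp
    then show ?thesis using jv[OF j] \<open>\<eta> j = 0\<close> \<eta>b by auto
  next
    assume a: "\<eta> j = 1" "slope (V j) i < slope (V j) (Suc i)"
    have "\<forall>\<^sub>F e in at_right 0. job_values (V' e j)"
      using eventually_job_values_raise[OF jv[OF j] a(2)] a(1) by (simp add: V'_def)
    moreover have "\<forall>\<^sub>F e in at_right 0. energy k (V' e j) < energy k (V j)"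
      using eventually_energy_less[of i k "\<eta> j" "V j"] i b(3) a by (simp add: V'_def)
    ultimately show ?thesis by eventually_elim auto
  next
    assume a: "\<eta> j = - 1" "j = b"
    have "\<forall>\<^sub>F e in at_right 0. job_values (V' e j)"
      using eventually_job_values_lower[OF jv[OF j], of i] desc a by (simp add: V'_def)
    moreover have "\<forall>\<^sub>F e in at_right 0. energy k (V' e j) < energy k (V j)"
      using eventually_energy_less[of i k "\<eta> j" "V j"] i b(3) a desc by (simp add: V'_def)
    ultimately show ?thesis by eventually_elim auto
  qed
  then have ev1: "\<forall>\<^sub>F e in at_right 0. \<forall>j\<in>J. job_values (V' e j) \<and> energy k (V' e j) \<le> energy k (V j)
      \<and> (j = b \<longrightarrow> energy k (V' e j) < energy k (V j))"
    by (intro eventually_ball_finite finite_J) blast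
  have ev2: "\<forall>\<^sub>F e in at_right 0. total_values (V' e)"
  proof -
    \<comment> \<open>The unused machine capacity in the cell after \<open>Suc i\<close>; any positive number will do if the
      total work does not change.\<close>
    define c where "c = (if sum \<eta> J = 0 then 1 else
      m * (\<tau> (Suc (Suc i)) - \<tau> (Suc i)) - (\<Sum>j\<in>J. V j (Suc (Suc i)) - V j (Suc i)))"
    have "0 < c" using \<eta>sum unfolding c_def by auto
    moreover have "total_values (V' e)" if e: "0 < e" "e < c" for e
      unfolding total_values_def
    proof
      fix l
      have t: "(\<Sum>j\<in>J. V j (Suc l) - V j l) \<le> m * (\<tau> (Suc l) - \<tau> l)" for l
        using tot unfolding total_values_def by blast
      consider "l = i" | "l = Suc i" | "l \<noteq> i" "l \<noteq> Suc i" by blast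
      then show "(\<Sum>j\<in>J. V' e j (Suc l) - V' e j l) \<le> m * (\<tau> (Suc l) - \<tau> l)"
      proof cases
        case 1
        have "(\<Sum>j\<in>J. V' e j (Suc l) - V' e j l) = (\<Sum>j\<in>J. (V j (Suc l) - V j l) + \<eta> j * e)"
          unfolding V'_def 1 by (intro sum.cong) auto
        also have "\<dots> = (\<Sum>j\<in>J. V j (Suc l) - V j l) + sum \<eta> J * e"
          by (simp add: sum.distrib sum_distrib_right)
        also have "\<dots> \<le> (\<Sum>j\<in>J. V j (Suc l) - V j l)"
          using \<eta>sum e by auto
        finally show ?thesis using t[of l] by linarith
      next
        case 2
        have "(\<Sum>j\<in>J. V' e j (Suc l) - V' e j l) = (\<Sum>j\<in>J. (V j (Suc l) - V j l) - \<eta> j * e)"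
          unfolding V'_def 2 by (intro sum.cong) auto
        also have "\<dots> = (\<Sum>j\<in>J. V j (Suc l) - V j l) - sum \<eta> J * e"
          by (simp add: sum_subtractf sum_distrib_right)
        finally show ?thesis using t[of l] \<eta>sum e unfolding c_def 2 by (auto split: if_splits)
      next
        case 3
        then have "(\<Sum>j\<in>J. V' e j (Suc l) - V' e j l) = (\<Sum>j\<in>J. V j (Suc l) - V j l)"
          unfolding V'_def by (intro sum.cong) auto
        then show ?thesis using t[of l] by simp
      qed
    qed
    ultimately show ?thesis unfolding eventually_at_right_field by blast
  qed
  have "\<forall>\<^sub>F e in at_right (0::real). 0 < e" by (rule eventually_at_right_less)
  with ev1 ev2 have "\<forall>\<^sub>F e in at_right 0. 0 < e \<and> total_values (V' e) \<and>
      (\<forall>j\<in>J. job_values (V' e j) \<and> energy k (V' e j) \<le> energy k (V j)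
      \<and> (j = b \<longrightarrow> energy k (V' e j) < energy k (V j)))"
    by eventually_elim blast
  then obtain e where e: "0 < e" "total_values (V' e)"
      "\<And>j. j \<in> J \<Longrightarrow> job_values (V' e j)" "\<And>j. j \<in> J \<Longrightarrow> energy k (V' e j) \<le> energy k (V j)"
      "energy k (V' e b) < energy k (V b)"
    using b(1) eventually_happens'[OF trivial_limit_at_right_real] by blast
  define W' where "W' j = interp (V' e j)" for j
  have "profile W'" unfolding W'_def by (rule profile_interp[OF e(3,2)])
  moreover have "0 \<le> d j \<and> p j \<le> W' j (d j)" if j: "j \<in> J" for j
  proof -
    obtain l where l: "d j = \<tau> l" using grid[OF j] by auto
    have "0 \<le> \<eta> j * e \<or> l \<noteq> Suc i"
    proof (cases "\<eta> j = - 1 \<and> j = b")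
      case True
      then have "l = n" using l b(2) tau_le[of l n] tau_le[of n l] by auto
      then show ?thesis using i by simp
    next
      case False
      then show ?thesis using \<eta>[OF j] e(1) by auto
    qed
    then have "V j l \<le> V' e j l" unfolding V'_def by auto
    moreover have "p j \<le> V j l" "0 \<le> d j" using W j unfolding plan_def V_def l[symmetric] by auto
    ultimately show ?thesis unfolding W'_def l interp_tau using l by simp
  qed
  ultimately have "plan d W'" unfolding plan_def by blast
  then have "(\<Sum>j\<in>J. energy k (V j)) \<le> (\<Sum>j\<in>J. energy k (V' e j))"
    using least[of W'] unfolding W'_def interp_tau V_def by simp
  moreover have "(\<Sum>j\<in>J. energy k (V' e j)) < (\<Sum>j\<in>J. energy k (V j))"
    using finite_J b(1) e(4,5) by (intro sum_strict_mono_ex1) auto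
  ultimately show False by simp
qed

text \<open>
  By convexity the graph lies above its supporting line at \<open>v\<close>. If that line is steeper than \<open>\<sigma>\<close>,
  the right end is higher than \<open>v\<close> relative to slope \<open>\<sigma>\<close>, and otherwise the left end is.
\<close>

lemma interp_peak:
  assumes inc: "\<And>i. Suc i < n \<Longrightarrow> slope V i \<le> slope V (Suc i)"
    and sv: "0 \<le> s" "s \<le> v" "v \<le> \<tau> n"
  shows "interp V v - \<sigma> * v \<le> max (interp V s - \<sigma> * s) (interp V (\<tau> n) - \<sigma> * \<tau> n)"
proof (cases "v = \<tau> n")
  case False
  then have line: "interp V v + slope V (cell v) * (t - v) \<le> interp V t" if "0 \<le> t" "t \<le> \<tau> n" for t
    using interp_supporting_line[OF inc, of n v t] that sv by auto
  show ?thesis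
  proof (cases "\<sigma> \<le> slope V (cell v)")
    case True
    have "\<sigma> * (\<tau> n - v) \<le> slope V (cell v) * (\<tau> n - v)" using True sv by (intro mult_right_mono) auto
    then show ?thesis using line[of "\<tau> n"] sv by (simp add: algebra_simps le_max_iff_disj)
  next
    case False
    have "\<sigma> * (s - v) \<le> slope V (cell v) * (s - v)" using False sv by (intro mult_right_mono_neg) auto
    then show ?thesis using line[of s] sv by (simp add: algebra_simps le_max_iff_disj)
  qed
qed simp

end

context cooled_jobs
begin

text \<open>
  Between consecutive deadlines the least-energy plan is replaced by its interpolation, which keeps
  the work done at every deadline.
\<close>

lemma optimal_grid:
  assumes opt: "optimal d"
  obtains \<tau> k V where "cooled_jobs_on_grid J m \<sigma> H p \<tau>" "d ` J = \<tau> ` {1..k}"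
    "\<And>j. j \<in> J \<Longrightarrow> cooled_jobs_on_grid.job_values \<sigma> H \<tau> (V j)"
    "cooled_jobs_on_grid.total_values J m \<tau> V"
    "plan d (\<lambda>j. time_grid.interp \<tau> (V j))"
    "\<And>a b. a \<in> J \<Longrightarrow> b \<in> J \<Longrightarrow> p b < p a \<Longrightarrow> d b \<le> d a"
proof -
  obtain W0 where W0: "plan d W0" using opt unfolding optimal_def by blast
  have d0: "0 < d j" if "j \<in> J" for j using plan_deadline_ge[OF W0 that] p_pos[OF that] by simp
  define k where "k = card (d ` J)"
  have "\<exists>\<tau>. time_grid \<tau> \<and> d ` J = \<tau> ` {1..k}"
    unfolding k_def by (rule finite_set_time_grid) (use finite_J d0 in auto)
  then obtain \<tau> where tg: "time_grid \<tau>" and im: "d ` J = \<tau> ` {1..k}" by blast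
  interpret time_grid \<tau> by (rule tg)
  interpret cooled_jobs_on_grid J m \<sigma> H p \<tau> by unfold_locales
  have "\<exists>W. plan d W \<and> (\<forall>W'. plan d W' \<longrightarrow>
      (\<Sum>j\<in>J. energy k (\<lambda>i. W j (\<tau> i))) \<le> (\<Sum>j\<in>J. energy k (\<lambda>i. W' j (\<tau> i))))"
  proof (rule least_plan[OF W0])
    have c: "continuous_on UNIV (\<lambda>W::'j \<Rightarrow> real \<Rightarrow> real. W j t)" for j t
    proof -
      have "continuous_on UNIV (\<lambda>W::'j \<Rightarrow> real \<Rightarrow> real. W j)"
        by (rule continuous_on_product_coordinates)
      then show ?thesis by (rule continuous_on_product_then_coordinatewise)
    qed
    have ne: "\<tau> (Suc i) - \<tau> i \<noteq> 0" for i using step_pos[of i] by simp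
    show "continuous_on UNIV (\<lambda>W. \<Sum>j\<in>J. energy k (\<lambda>i. W j (\<tau> i)))"
      unfolding energy_def
      by (intro continuous_on_sum continuous_on_divide continuous_on_power continuous_on_diff c
          continuous_on_const ballI ne)
    show "(\<Sum>j\<in>J. energy k (\<lambda>i. W j (\<tau> i))) = (\<Sum>j\<in>J. energy k (\<lambda>i. W' j (\<tau> i)))"
      if "\<And>j t. j \<in> J \<Longrightarrow> 0 \<le> t \<Longrightarrow> W j t = W' j t" for W W'
      using that tau_nonneg unfolding energy_def by (intro sum.cong) auto
  qed
  then obtain W where W: "plan d W" and least: "\<And>W'. plan d W' \<Longrightarrow>
      (\<Sum>j\<in>J. energy k (\<lambda>i. W j (\<tau> i))) \<le> (\<Sum>j\<in>J. energy k (\<lambda>i. W' j (\<tau> i)))" by blast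
  define V where "V j i = W j (\<tau> i)" for j i
  have prof: "profile W" using W by (simp add: plan_def)
  have jv: "job_values (V j)" if "j \<in> J" for j
    using job_values_sample[OF prof that] unfolding V_def .
  have tot: "total_values V" using total_values_sample[OF prof] unfolding V_def .
  have at_deadline: "\<exists>n. d j = \<tau> n \<and> n \<le> k" if "j \<in> J" for j
  proof -
    have "d j \<in> \<tau> ` {1..k}" using that im by blast
    then show ?thesis by auto
  qed
  have pl: "plan d (\<lambda>j. interp (V j))"
    unfolding plan_def
  proof (intro conjI ballI)
    show "profile (\<lambda>j. interp (V j))" by (rule profile_interp[OF jv tot])
    fix j assume j: "j \<in> J"
    obtain n where n: "d j = \<tau> n" using at_deadline[OF j] by blast
    show "0 \<le> d j" "p j \<le> interp (V j) (d j)"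
      using W j unfolding n interp_tau V_def plan_def by (auto simp: n)
  qed
  have order: "d b \<le> d a" if ab: "a \<in> J" "b \<in> J" "p b < p a" for a b
  proof -
    obtain n where n: "d b = \<tau> n" "n \<le> k" using at_deadline[OF ab(2)] by blast
    have "d j \<in> range \<tau>" if "j \<in> J" for j using at_deadline[OF that] by auto
    then have "slope (V b) i \<le> slope (V b) (Suc i)" if "Suc i < n" for i
      using least_energy_slopes[OF W least _ ab(2) n that] unfolding V_def by blast
    then show ?thesis
      unfolding n(1)[symmetric]
      by (intro optimal_order[OF opt pl ab] interp_peak[of n "V b", folded n(1)])
  qed
  show thesis by (rule that[OF _ im jv tot pl order]) unfold_locales
qed

end

section \<open>Schedules and plans\<close>

lemma schedule_integrable:
  assumes S: "is_schedule J S" and j: "j \<in> J" and uv: "0 \<le> u"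
  shows "S j integrable_on {u..v}"
proof (cases "u \<le> v")
  case True
  then have "S j absolutely_integrable_on {0..v}" using S j uv unfolding is_schedule_def by auto
  then have "S j integrable_on {0..v}" by (rule set_lebesgue_integral_eq_integral(1))
  then show ?thesis by (rule integrable_subinterval_real) (use uv in auto)
qed (simp add: integrable_on_empty)

lemma work_increment:
  assumes S: "is_schedule J S" and j: "j \<in> J" and uv: "0 \<le> u" "u \<le> v"
  shows "work S j v - work S j u = integral {u..v} (S j)"
  using Henstock_Kurzweil_Integration.integral_combine[OF uv schedule_integrable[OF S j order_refl]]
  unfolding work_def by simp

lemma work_increment_bounds:
  assumes S: "is_schedule J S" and M: "manageable n J S" and j: "j \<in> J" and uv: "0 \<le> u" "u \<le> v"
  shows "0 \<le> work S j v - work S j u" "work S j v - work S j u \<le> v - u"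
proof -
  have int: "S j integrable_on {u..v}" by (rule schedule_integrable[OF S j uv(1)])
  have "0 \<le> integral {u..v} (S j)"
    using S j uv unfolding is_schedule_def by (intro integral_nonneg int) auto
  moreover have "integral {u..v} (S j) \<le> integral {u..v} (\<lambda>_. 1)"
    using M j uv unfolding manageable_def by (intro integral_le int) auto
  ultimately show "0 \<le> work S j v - work S j u" "work S j v - work S j u \<le> v - u"
    unfolding work_increment[OF S j uv] using uv by auto
qed

lemma total_work_increment_le:
  assumes S: "is_schedule J S" and M: "manageable n J S" and J: "finite J" and uv: "0 \<le> u" "u \<le> v"
  shows "(\<Sum>j\<in>J. work S j v - work S j u) \<le> real n * (v - u)"
proof -
  have "(\<Sum>j\<in>J. work S j v - work S j u) = (\<Sum>j\<in>J. integral {u..v} (S j))"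
    by (intro sum.cong refl work_increment[OF S _ uv])
  also have "\<dots> = integral {u..v} (\<lambda>t. \<Sum>j\<in>J. S j t)"
    by (rule Henstock_Kurzweil_Integration.integral_sum[symmetric, OF J schedule_integrable[OF S _ uv(1)]])
  also have "\<dots> \<le> integral {u..v} (\<lambda>_. real n)"
    using M uv unfolding manageable_def
    by (intro integral_le integrable_sum J schedule_integrable[OF S _ uv(1)]) auto
  also have "\<dots> = real n * (v - u)" using uv by simp
  finally show ?thesis .
qed

lemma completion_time_attained:
  assumes S: "is_schedule J S" and C: "all_completed p J S" and j: "j \<in> J"
  shows "0 \<le> completion_time p S j" "p j \<le> work S j (completion_time p S j)"
proof -
  obtain t0 where t0: "0 \<le> t0" "p j \<le> work S j t0" using C j unfolding all_completed_def by blast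
  define E where "E = {t \<in> {0..t0}. p j \<le> work S j t}"
  have "continuous_on {0..t0} (work S j)"
    using indefinite_integral_continuous_1[OF schedule_integrable[OF S j order_refl, of t0]]
    unfolding work_def .
  then have "closed E" unfolding E_def
    by (intro continuous_on_closed_Collect_le continuous_on_const) simp_all
  then have "compact E" unfolding E_def
    by (metis (no_types, lifting) bounded_closed_interval bounded_subset compact_eq_bounded_closed
        mem_Collect_eq subsetI)
  moreover have "E \<noteq> {}" using t0 unfolding E_def by auto
  ultimately obtain s where s: "s \<in> E" "\<forall>t\<in>E. s \<le> t"
    using compact_attains_inf[of E] by auto
  have "completion_time p S j = s"
    unfolding completion_time_def
  proof (rule Least_equality)
    show "0 \<le> s \<and> p j \<le> work S j s" using s unfolding E_def by auto
    fix t assume t: "0 \<le> t \<and> p j \<le> work S j t"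
    show "s \<le> t"
    proof (cases "t \<le> t0")
      case True
      then show ?thesis using s t unfolding E_def by auto
    next
      case False
      then show ?thesis using s unfolding E_def by auto
    qed
  qed
  then show "0 \<le> completion_time p S j" "p j \<le> work S j (completion_time p S j)"
    using s unfolding E_def by auto
qed

lemma work_has_derivative:
  assumes S: "is_schedule J S" and j: "j \<in> J" and lu: "0 \<le> l" "l < t" "t < u"
    and const: "\<And>x. x \<in> {l..<u} \<Longrightarrow> S j x = S j t"
  shows "(work S j has_real_derivative S j t) (at t)"
proof -
  have "continuous_on {l<..<u} (S j)"
    by (rule continuous_on_eq[of _ "\<lambda>_. S j t"]) (use const in auto)
  then have "isCont (S j) t" using lu by (simp add: continuous_on_eq_continuous_at)
  then have "continuous (at t within ({0..u} - {})) (S j)" by (rule continuous_at_imp_continuous_at_within)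
  then have "((\<lambda>x. integral {0..x} (S j)) has_vector_derivative S j t) (at t within ({0..u} - {}))"
    using lu by (intro integral_has_vector_derivative_continuous_at schedule_integrable[OF S j]) auto
  moreover have "at t within ({0..u} - {}) = at t"
    using lu by (intro at_within_interior) auto
  ultimately show ?thesis
    unfolding work_def[abs_def] has_real_derivative_iff_has_vector_derivative by simp
qed

lemma normalized_window:
  fixes \<alpha> \<beta> :: real
  assumes "\<alpha> < 0" "0 < \<beta>"
  shows "(\<beta> - \<alpha>) * (1 / (\<beta> - \<alpha>) + - \<alpha> / (\<beta> - \<alpha>) * x) = 1 - \<alpha> * x"
proof -
  have "k * (1 / k + - \<alpha> / k * x) = 1 - \<alpha> * x" if "k \<noteq> 0" for k
    using that by (simp add: field_simps)
  then show ?thesis using assms by simp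
qed

context cooled_jobs
begin

text \<open>
  The work functions of the schedule, stopped at the last completion time \<open>b\<close>. Normality makes
  the loads constant near all but finitely many times before \<open>b\<close>, so the work is
  differentiable there with the load as derivative.
\<close>

lemma plan_of_schedule:
  assumes rates: "\<alpha> < 0" "0 < \<beta>" "\<sigma> = - \<alpha> / (\<beta> - \<alpha>)" "H = 1 / (\<beta> - \<alpha>)"
    and mn: "m = real n"
    and S: "S \<in> feasible_normal_schedules \<alpha> \<beta> n p J"
  shows "\<exists>W. plan (completion_time p S) W"
proof -
  have sched: "is_schedule J S" and man: "manageable n J S" and comp: "all_completed p J S"
    and temp: "\<And>j. j \<in> J \<Longrightarrow> \<exists>T. is_temperature \<alpha> \<beta> (S j) T \<and> (\<forall>t\<ge>0. T t \<le> 1)"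
    and norm: "simple_witnessed_by J S (completion_time p S ` J)"
    using S unfolding feasible_normal_schedules_def feasible_def normal_schedule_def by auto
  obtain k :: nat and \<theta> :: "nat \<Rightarrow> real" where w: "\<theta> 0 = 0 \<and> strict_mono_on {0..k} \<theta> \<and> completion_time p S ` J = \<theta> ` {1..k} \<and>
      (\<forall>i\<in>{1..k}. \<forall>j\<in>J. \<forall>t\<in>{\<theta> (i - 1)..<\<theta> i}. \<forall>t'\<in>{\<theta> (i - 1)..<\<theta> i}. S j t = S j t')"
    using norm unfolding simple_witnessed_by_def by blast
  then have \<theta>: "\<theta> 0 = 0" "strict_mono_on {0..k} \<theta>" "completion_time p S ` J = \<theta> ` {1..k}"
    by simp_all
  have load_const: "S j t = S j t'" if "i \<in> {1..k}" "j \<in> J" "t \<in> {\<theta> (i - 1)..<\<theta> i}"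
      "t' \<in> {\<theta> (i - 1)..<\<theta> i}" for i j t t'
    by (rule conjunct2[OF conjunct2[OF conjunct2[OF w]], rule_format, OF that])
  have \<theta>_mono: "\<theta> i \<le> \<theta> l" if "i \<le> l" "l \<le> k" for i l
    using strict_mono_onD[OF \<theta>(2), of i l] that by (cases "i = l") auto
  define b where "b = \<theta> k"
  have b0: "0 \<le> b" using \<theta>_mono[of 0 k] \<theta>(1) unfolding b_def by simp
  have Cb: "completion_time p S j \<le> b" if "j \<in> J" for j
  proof -
    have "completion_time p S j \<in> \<theta> ` {1..k}" using that \<theta>(3) by blast
    then show ?thesis using \<theta>_mono unfolding b_def by auto
  qed
  have deriv: "(work S j has_real_derivative S j t) (at t)"
    if j: "j \<in> J" and t: "0 < t" "t < b" "t \<notin> \<theta> ` {..k}" for j t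
  proof -
    define i where "i = (LEAST i. t < \<theta> i)"
    have ti: "t < \<theta> i" using t(2) unfolding i_def b_def by (rule LeastI)
    have ik: "i \<le> k" using t(2) unfolding i_def b_def by (rule Least_le)
    have "i \<noteq> 0" using ti t(1) \<theta>(1) by (metis less_asym)
    then obtain l where l: "i = Suc l" by (cases i) auto
    have "\<not> t < \<theta> l" using l unfolding i_def by (metis lessI not_less_Least)
    moreover have "t \<noteq> \<theta> l" using t(3) ik l by auto
    ultimately have tl: "\<theta> l < t" by simp
    have l0: "0 \<le> \<theta> l" using \<theta>_mono[of 0 l] \<theta>(1) ik l by simp
    show ?thesis
    proof (rule work_has_derivative[OF sched j l0 tl ti])
      fix x assume "x \<in> {\<theta> l..<\<theta> i}"
      then show "S j x = S j t" using load_const[of i j x t] j ik l tl ti by simp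
    qed
  qed
  have window: "work S j v - work S j u \<le> H + \<sigma> * (v - u)"
    if j: "j \<in> J" and uv: "0 \<le> u" "u \<le> v" "v \<le> b" for j u v
  proof -
    obtain T where T: "is_temperature \<alpha> \<beta> (S j) T" "\<And>t. 0 \<le> t \<Longrightarrow> T t \<le> 1" using temp[OF j] by blast
    have "(\<beta> - \<alpha>) * (work S j v - work S j u) + \<alpha> * (v - u) \<le> T v - T u"
    proof (rule temperature_increase_ge_drift[OF T(1), of "\<theta> ` {..k}" b "work S j" 1])
      show "\<bar>work S j y - work S j x\<bar> \<le> 1 * (y - x)" if "0 \<le> x" "x \<le> y" for x y
        using work_increment_bounds[OF sched man j that] by simp
    qed (use uv deriv[OF j] in auto)
    moreover have "T v \<le> 1" "0 \<le> T u" using T uv unfolding is_temperature_def by auto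
    ultimately have "(\<beta> - \<alpha>) * (work S j v - work S j u) \<le> 1 - \<alpha> * (v - u)" by simp
    also have "\<dots> = (\<beta> - \<alpha>) * (H + \<sigma> * (v - u))"
      unfolding rates(3,4) by (rule normalized_window[OF rates(1,2), symmetric])
    finally show ?thesis using rates by simp
  qed
  define W where "W j t = work S j (min t b)" for j t
  have "profile W"
    unfolding profile_def
  proof (intro conjI ballI allI impI)
    show "W j 0 = 0" for j using b0 unfolding W_def work_def by simp
    fix u v :: real assume uv: "0 \<le> u \<and> u \<le> v"
    define x y where "x = min u b" and "y = min v b"
    have xy: "0 \<le> x" "x \<le> y" "y \<le> b" "y - x \<le> v - u" using uv b0 unfolding x_def y_def by auto
    have W: "W j v = work S j y" "W j u = work S j x" for j unfolding W_def x_def y_def by auto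
    show "W j u \<le> W j v" "W j v - W j u \<le> v - u" "W j v - W j u \<le> H + \<sigma> * (v - u)" if j: "j \<in> J" for j
    proof -
      have "\<sigma> * (y - x) \<le> \<sigma> * (v - u)" using xy \<sigma>_pos by simp
      then show "W j u \<le> W j v" "W j v - W j u \<le> v - u" "W j v - W j u \<le> H + \<sigma> * (v - u)"
        using work_increment_bounds[OF sched man j xy(1,2)] window[OF j xy(1-3)] xy unfolding W by auto
    qed
    have "m * (y - x) \<le> m * (v - u)" using xy m_ge by simp
    then show "(\<Sum>j\<in>J. W j v - W j u) \<le> m * (v - u)"
      using total_work_increment_le[OF sched man finite_J xy(1,2)] unfolding W mn by simp
  qed
  moreover have "0 \<le> completion_time p S j \<and> p j \<le> W j (completion_time p S j)" if "j \<in> J" for j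
    using completion_time_attained[OF sched comp that] Cb[OF that] unfolding W_def by simp
  ultimately show ?thesis unfolding plan_def by blast
qed

end

context cooled_jobs_on_grid
begin

text \<open>
  Conversely, slopes serve as loads. The temperature is the reflected drift \<open>(\<beta> - \<alpha>) V + \<alpha> \<tau>\<close>,
  whose increments are at most \<open>1\<close> by the heat bound.
\<close>

lemma schedule_of_values:
  assumes rates: "\<alpha> < 0" "0 < \<beta>" "\<sigma> = - \<alpha> / (\<beta> - \<alpha>)" "H = 1 / (\<beta> - \<alpha>)"
    and mn: "m = real n"
    and V: "\<And>j. j \<in> J \<Longrightarrow> job_values (V j)" and tot: "total_values V"
  defines "S \<equiv> \<lambda>j t. slope (V j) (cell t)"
  shows "feasible \<alpha> \<beta> n J S"
    and "\<And>j t. j \<in> J \<Longrightarrow> 0 \<le> t \<Longrightarrow> work S j t = interp (V j) t"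
proof -
  have prof: "profile (\<lambda>j. interp (V j))" by (rule profile_interp[OF V tot])
  have sl: "0 \<le> slope (V j) i \<and> slope (V j) i \<le> 1" if "j \<in> J" for j i
  proof -
    have "V j i \<le> V j (Suc i)" "V j (Suc i) - V j i \<le> \<tau> (Suc i) - \<tau> i"
      using V[OF that] unfolding job_values_def by blast+
    then show ?thesis using step_pos[of i] unfolding slope_def by simp
  qed
  have abs_sl: "\<bar>slope (V j) i\<bar> \<le> 1" if "j \<in> J" for j i using sl[OF that, of i] by simp
  have int: "(S j has_integral interp (V j) t) {0..t}" if "j \<in> J" "0 \<le> t" for j t
    using slope_has_integral[OF abs_sl[OF that(1)] that(2)] V[OF that(1)]
    unfolding S_def job_values_def by simp
  then show "work S j t = interp (V j) t" if "j \<in> J" "0 \<le> t" for j t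
    using that unfolding work_def by (blast intro: integral_unique)
  have "is_schedule J S"
    unfolding is_schedule_def
  proof (intro conjI ballI allI impI)
    fix j t assume j: "j \<in> J" and t: "0 \<le> (t::real)"
    show "0 \<le> S j t" using sl[OF j] unfolding S_def by blast
    show "S j absolutely_integrable_on {0..t}"
      using int[OF j t] sl[OF j] unfolding S_def
      by (intro nonnegative_absolutely_integrable_1) (auto simp: integrable_on_def)
  qed
  moreover have "manageable n J S"
    unfolding manageable_def
  proof (intro conjI ballI allI impI)
    show "S j t \<le> 1" if "j \<in> J" for j t using sl[OF that] unfolding S_def by blast
    fix t :: real
    define i where "i = cell t"
    have "(\<Sum>j\<in>J. S j t) = (\<Sum>j\<in>J. V j (Suc i) - V j i) / (\<tau> (Suc i) - \<tau> i)"
      unfolding S_def i_def slope_def by (rule sum_divide_distrib[symmetric])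
    also have "\<dots> \<le> m"
      using tot step_pos[of i] unfolding total_values_def by (simp add: pos_divide_le_eq)
    finally show "(\<Sum>j\<in>J. S j t) \<le> real n" unfolding mn .
  qed
  moreover have "\<exists>T. is_temperature \<alpha> \<beta> (S j) T \<and> (\<forall>t\<ge>0. T t \<le> 1)" if j: "j \<in> J" for j
  proof -
    define X where "X i = (\<beta> - \<alpha>) * V j i + \<alpha> * \<tau> i" for i
    have slX: "slope X i = \<alpha> * (1 - slope (V j) i) + \<beta> * slope (V j) i" for i
    proof -
      have "slope X i = ((\<beta> - \<alpha>) * (V j (Suc i) - V j i) + \<alpha> * (\<tau> (Suc i) - \<tau> i)) / (\<tau> (Suc i) - \<tau> i)"
        unfolding slope_def X_def by (simp add: algebra_simps)
      also have "\<dots> = (\<beta> - \<alpha>) * slope (V j) i + \<alpha>"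
        using step_pos[of i] unfolding slope_def by (simp add: add_divide_distrib)
      finally show ?thesis by (simp add: algebra_simps)
    qed
    have bound: "\<bar>slope X i\<bar> \<le> \<bar>\<alpha>\<bar> + \<bar>\<beta>\<bar>" for i
    proof -
      have "\<bar>slope X i\<bar> \<le> \<bar>\<alpha>\<bar> * \<bar>1 - slope (V j) i\<bar> + \<bar>\<beta>\<bar> * \<bar>slope (V j) i\<bar>"
        unfolding slX by (metis abs_mult abs_triangle_ineq)
      also have "\<dots> \<le> \<bar>\<alpha>\<bar> * 1 + \<bar>\<beta>\<bar> * 1"
        using sl[OF j, of i] by (intro add_mono mult_left_mono) auto
      finally show ?thesis by simp
    qed
    have interpX: "interp X t = (\<beta> - \<alpha>) * interp (V j) t + \<alpha> * t" for t
      unfolding interp_def slX by (simp add: X_def algebra_simps)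
    have "is_temperature \<alpha> \<beta> (S j) (reflected X)"
      unfolding S_def by (rule reflected_is_temperature[OF bound slX])
    moreover have "reflected X t \<le> 1" if t: "0 \<le> t" for t
    proof (rule reflected_le[OF bound t])
      fix x assume x: "0 \<le> x" "x \<le> t"
      have "(\<beta> - \<alpha>) * (interp (V j) t - interp (V j) x) \<le> (\<beta> - \<alpha>) * (H + \<sigma> * (t - x))"
        using profile_window[OF prof j x] rates by (intro mult_left_mono) auto
      also have "\<dots> = 1 - \<alpha> * (t - x)"
        unfolding rates(3,4) by (rule normalized_window[OF rates(1,2)])
      finally show "interp X t - interp X x \<le> 1" unfolding interpX by (simp add: algebra_simps)
    qed
    ultimately show ?thesis by blast
  qed
  ultimately show "feasible \<alpha> \<beta> n J S" unfolding feasible_def by blast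
qed

end

text \<open>
  Optimality makes the deadlines the completion times, so the grid of deadlines
  witnesses normality.
\<close>

lemma (in cooled_jobs) schedule_of_optimal:
  assumes rates: "\<alpha> < 0" "0 < \<beta>" "\<sigma> = - \<alpha> / (\<beta> - \<alpha>)" "H = 1 / (\<beta> - \<alpha>)"
    and mn: "m = real n" and opt: "optimal d"
  obtains S where "S \<in> feasible_normal_schedules \<alpha> \<beta> n p J"
    "\<And>j. j \<in> J \<Longrightarrow> completion_time p S j = d j"
    "\<And>a b. a \<in> J \<Longrightarrow> b \<in> J \<Longrightarrow> p b < p a \<Longrightarrow> d b \<le> d a"
proof (rule optimal_grid[OF opt])
  fix \<tau> k V
  assume grid: "cooled_jobs_on_grid J m \<sigma> H p \<tau>" and im: "d ` J = \<tau> ` {1..k}"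
    and V: "\<And>j. j \<in> J \<Longrightarrow> cooled_jobs_on_grid.job_values \<sigma> H \<tau> (V j)"
    and tot: "cooled_jobs_on_grid.total_values J m \<tau> V"
    and pl: "plan d (\<lambda>j. time_grid.interp \<tau> (V j))"
    and order: "\<And>a b. a \<in> J \<Longrightarrow> b \<in> J \<Longrightarrow> p b < p a \<Longrightarrow> d b \<le> d a"
  interpret cooled_jobs_on_grid J m \<sigma> H p \<tau> by (rule grid)
  define S where "S = (\<lambda>j t. slope (V j) (cell t))"
  have feas: "feasible \<alpha> \<beta> n J S"
    unfolding S_def by (rule schedule_of_values(1)[OF rates mn V tot])
  have workS: "work S j t = interp (V j) t" if "j \<in> J" "0 \<le> t" for j t
    unfolding S_def by (rule schedule_of_values(2)[OF rates mn V tot that])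
  have d: "0 \<le> d j \<and> p j \<le> work S j (d j)" if "j \<in> J" for j
    using pl workS[OF that, of "d j"] that unfolding plan_def by auto
  have C: "completion_time p S j = d j" if j: "j \<in> J" for j
    unfolding completion_time_def
  proof (rule Least_equality, rule d[OF j])
    fix t assume "0 \<le> t \<and> p j \<le> work S j t"
    then show "d j \<le> t" using optimal_plan_tight(1)[OF opt pl j, of t] workS[OF j, of t] by simp
  qed
  have im': "completion_time p S ` J = \<tau> ` {1..k}"
    unfolding im[symmetric] by (rule image_cong) (simp_all add: C)
  have "simple_witnessed_by J S (completion_time p S ` J)"
    unfolding simple_witnessed_by_def im'
  proof (intro exI[of _ k] exI[of _ \<tau>] conjI ballI refl)
    show "\<tau> 0 = 0" by (rule start)
    show "strict_mono_on {0..k} \<tau>" by (rule strict_mono_onI) (simp add: tau_less)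
    fix i j t t' assume i: "i \<in> {1..k}" and t: "t \<in> {\<tau> (i - 1)..<\<tau> i}" "t' \<in> {\<tau> (i - 1)..<\<tau> i}"
    have "cell t = i - 1" "cell t' = i - 1" using i t by (auto intro!: cell_eqI)
    then show "S j t = S j t'" unfolding S_def by simp
  qed
  moreover have "all_completed p J S" unfolding all_completed_def using d by blast
  ultimately have "S \<in> feasible_normal_schedules \<alpha> \<beta> n p J"
    unfolding feasible_normal_schedules_def normal_schedule_def using feas by blast
  then show thesis by (rule that[OF _ C order])
qed

theorem theorem3:
  fixes J :: "'j set" and p :: "'j \<Rightarrow> real" and \<alpha> \<beta> :: real and m :: nat
  assumes "m \<ge> 1"
    and "finite J" and "J \<noteq> {}"
    and "\<forall>j\<in>J. 0 < p j \<and> p j \<in> \<rat>"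
    and "\<alpha> < 0" and "\<alpha> \<in> \<rat>"
    and "\<beta> > 0" and "\<beta> \<in> \<rat>"
  shows "\<exists>S \<in> feasible_normal_schedules \<alpha> \<beta> m p J.
           (\<Sum>j\<in>J. completion_time p S j)
             = Inf ((\<lambda>S'. \<Sum>j\<in>J. completion_time p S' j) ` feasible_normal_schedules \<alpha> \<beta> m p J) \<and>
           (\<forall>i\<in>J. \<forall>j\<in>J. p i < p j \<longrightarrow> completion_time p S i \<le> completion_time p S j)"
proof -
  define \<sigma> H where "\<sigma> = - \<alpha> / (\<beta> - \<alpha>)" and "H = 1 / (\<beta> - \<alpha>)"
  have pos: "0 < \<beta> - \<alpha>" using assms(5,7) by simp
  have "0 < \<sigma>" unfolding \<sigma>_def using assms(5) pos by (intro divide_pos_pos) auto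
  moreover have "\<sigma> < 1" unfolding \<sigma>_def by (subst pos_divide_less_eq[OF pos]) (use assms(7) in simp)
  moreover have "0 < H" unfolding H_def using pos by simp
  ultimately interpret cooled_jobs J "real m" \<sigma> H p
    by unfold_locales (use assms in auto)
  obtain d where opt: "optimal d" using optimal_exists by blast
  obtain S where S: "S \<in> feasible_normal_schedules \<alpha> \<beta> m p J"
    "\<And>j. j \<in> J \<Longrightarrow> completion_time p S j = d j"
    "\<And>a b. a \<in> J \<Longrightarrow> b \<in> J \<Longrightarrow> p b < p a \<Longrightarrow> d b \<le> d a"
    using schedule_of_optimal[OF assms(5,7) \<sigma>_def H_def refl opt] by blast
  have "sum d J \<le> (\<Sum>j\<in>J. completion_time p S' j)"
    if "S' \<in> feasible_normal_schedules \<alpha> \<beta> m p J" for S'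
    using plan_of_schedule[OF assms(5,7) \<sigma>_def H_def refl that] opt unfolding optimal_def by blast
  moreover have sum_S: "(\<Sum>j\<in>J. completion_time p S j) = sum d J"
    by (rule sum.cong) (simp_all add: S(2))
  ultimately have "(\<Sum>j\<in>J. completion_time p S j) \<le> x"
    if "x \<in> (\<lambda>S'. \<Sum>j\<in>J. completion_time p S' j) ` feasible_normal_schedules \<alpha> \<beta> m p J" for x
    using that by auto
  then have "(\<Sum>j\<in>J. completion_time p S j)
      = Inf ((\<lambda>S'. \<Sum>j\<in>J. completion_time p S' j) ` feasible_normal_schedules \<alpha> \<beta> m p J)"
    by (rule cInf_eq_minimum[symmetric, OF imageI[OF S(1)]])
  then show ?thesis using S by (intro bexI[of _ S] conjI) auto
qed

end
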